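(* Let $d\ge 1$, $n\ge 2$ and $1\le s\le\binom{n+d-1}{d}$ be integers. Let $\ell_1,\dots,\ell_s\in[S]_1$ be general linear forms, let $F_s=\ell_1^d+\cdots+\ell_s^d\in[S]_d$, and let $A_{F_s}=R/\operatorname{Ann}_R(F_s)$ be the Artinian Gorenstein graded $\mathbb{K}$-algebra of socle degree $d$ with Macaulay dual generator $F_s$. Let $(h_0,\dots,h_d)$ be the $h$-vector of $A_{F_s}$, let $\alpha_i=h_i-h_{i-1}$ (with $h_{-1}=0$), let $r_s$ be the unique integer with $\binom{n-2+r_s}{n-1}<s\le\binom{n-1+r_s}{n-1}$, and put $m=\min\{r_s,\lfloor d/2\rfloor\}$. Then the generic linear Jordan type of $A_{F_s}$ is $$P_{\ell,A_{F_s}}=\big((d+1),(d-1)^{\alpha_1},(d-3)^{\alpha_2},\dots,(d+1-2i)^{\alpha_i},\dots,(d+1-2m)^{\alpha_m}\big),$$ i.e. the partition in which the part $d+1-2i$ occurs exactly $\alpha_i$ times for each $0\le i\le m$.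
   Context: $\mathbb{K}$ is an algebraically closed field of characteristic zero, $R=\mathbb{K}[x_1,\dots,x_n]$ and $S=\mathbb{K}[X_1,\dots,X_n]$ with the standard grading. $R$ acts on $S$ by differentiation, $x_i=\partial/\partial X_i$; $\operatorname{Ann}_R(F)=\{p\in R : p(\partial/\partial X_1,\dots,\partial/\partial X_n)\circ F=0\}$. If $F\neq 0$ is homogeneous of degree $d$, then $R/\operatorname{Ann}_R(F)$ is Artinian Gorenstein of socle degree $d$ and $F$ is called its Macaulay dual generator. The $h$-vector of a graded Artinian algebra $A$ of socle degree $d$ is $(h_0,\dots,h_d)$ with $h_i=\dim_{\mathbb{K}}[A]_i$. For a standard graded Artinian $\mathbb{K}$-algebra $A$ and a linear form $\ell\in[A]_1$, the Jordan type $P_{\ell,A}$ is the partition of $\dim_{\mathbb{K}}A$ given by the sizes of the Jordan blocks of the nilpotent map $\times\ell:A\to A$. The generic linear Jordan type of $A$ is $P_{\ell,A}$ for a general $\ell\in[A]_1$, i.e. the common value of $P_{\ell,A}$ for $\ell$ in a suitable dense Zariski open subset of $[A]_1$. The notation $p^{a}$ in a partition means the part $p$ repeated $a$ times. "General" for the forms defining $F_s$: writing $\ell_i=a_{i,1}X_1+\cdots+a_{i,n}X_n$, a statement holds for general $\ell_1,\dots,\ell_s$ if there is a nonempty (dense) Zariski open subset $U\subset \mathbb{K}^{ns}$ such that it holds whenever $(a_{1,1},\dots,a_{1,n},\dots,a_{s,1},\dots,a_{s,n})\in U$. *)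

theory Defs
  imports
    "HOL-Library.Poly_Mapping"
    "HOL-Library.FuncSet"
    "HOL-Library.Cardinality"
    "HOL-Computational_Algebra.Polynomial"
    "HOL-Algebra.QuotRing"
    "HOL-Algebra.Embedded_Algebras"
    "Jordan_Normal_Form.Jordan_Normal_Form"
begin

section \<open>Polynomials in the variables indexed by a type\<close>

text \<open>A polynomial maps exponent vectors to coefficients. The same type serves for
  \<open>R = K[x\<^sub>1,\<dots>,x\<^sub>n]\<close> and \<open>S = K[X\<^sub>1,\<dots>,X\<^sub>n]\<close>; the number of variables is
  \<open>n = CARD('n)\<close> when the index type is finite.\<close>

type_synonym ('n, 'k) mpoly = "('n \<Rightarrow>\<^sub>0 nat) \<Rightarrow>\<^sub>0 'k"

definition mconst :: "'k \<Rightarrow> ('n, 'k::zero) mpoly" where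
  "mconst c = Poly_Mapping.single 0 c"

definition mpoly_eval :: "('n, 'k::comm_semiring_1) mpoly \<Rightarrow> ('n \<Rightarrow> 'k) \<Rightarrow> 'k" where
  "mpoly_eval p a = (\<Sum>m\<in>Poly_Mapping.keys p.
     Poly_Mapping.lookup p m * (\<Prod>i\<in>Poly_Mapping.keys m. a i ^ Poly_Mapping.lookup m i))"

definition hom_part :: "nat \<Rightarrow> ('n, 'k::zero) mpoly set" where
  "hom_part i = {p. \<forall>m\<in>Poly_Mapping.keys p.
     (\<Sum>j\<in>Poly_Mapping.keys m. Poly_Mapping.lookup m j) = i}"

definition lin_form :: "('n::finite \<Rightarrow> 'k::semiring_1) \<Rightarrow> ('n, 'k) mpoly" where
  "lin_form a = (\<Sum>j\<in>UNIV. Poly_Mapping.single (Poly_Mapping.single j 1) (a j))"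

text \<open>\<open>F\<^sub>s = \<ell>\<^sub>1\<^sup>d + \<cdots> + \<ell>\<^sub>s\<^sup>d\<close> with \<open>\<ell>\<^sub>i = a\<^sub>i\<^sub>,\<^sub>1 X\<^sub>1 + \<cdots> + a\<^sub>i\<^sub>,\<^sub>n X\<^sub>n\<close>\<close>

definition power_sum :: "nat \<Rightarrow> nat \<Rightarrow> (nat \<times> 'n::finite \<Rightarrow> 'k::comm_ring_1) \<Rightarrow> ('n, 'k) mpoly" where
  "power_sum d s a = (\<Sum>i\<in>{1..s}. lin_form (\<lambda>j. a (i, j)) ^ d)"

section \<open>The action by differentiation and the annihilator\<close>

text \<open>Truncated subtraction in the exponent is harmless: the coefficient is then 0.\<close>

definition pdiff :: "'n \<Rightarrow> ('n, 'k::semiring_1) mpoly \<Rightarrow> ('n, 'k) mpoly" where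
  "pdiff i F = (\<Sum>m\<in>Poly_Mapping.keys F.
     Poly_Mapping.single (m - Poly_Mapping.single i 1)
       (of_nat (Poly_Mapping.lookup m i) * Poly_Mapping.lookup F m))"

text \<open>The composite of the operators \<open>(\<partial>/\<partial>X\<^sub>i)\<^bsup>m\<^sub>i\<^esup>\<close>; by lemma \<open>pdiff_comp_fun_commute\<close> below
  the order in which the fold composes them is irrelevant.\<close>

definition pdiff_monom :: "('n \<Rightarrow>\<^sub>0 nat) \<Rightarrow> ('n, 'k::semiring_1) mpoly \<Rightarrow> ('n, 'k) mpoly" where
  "pdiff_monom m F =
     Finite_Set.fold (\<lambda>i. pdiff i ^^ Poly_Mapping.lookup m i) F (Poly_Mapping.keys m)"

definition diff_act :: "('n, 'k::semiring_1) mpoly \<Rightarrow> ('n, 'k) mpoly \<Rightarrow> ('n, 'k) mpoly" where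
  "diff_act p F = (\<Sum>m\<in>Poly_Mapping.keys p.
     mconst (Poly_Mapping.lookup p m) * pdiff_monom m F)"

definition ann :: "('n, 'k::semiring_1) mpoly \<Rightarrow> ('n, 'k) mpoly set" where
  "ann F = {p. diff_act p F = 0}"

lemma lookup_pdiff:
  fixes F :: "('n, 'k::semiring_1) mpoly"
  shows "Poly_Mapping.lookup (pdiff i F) m =
    of_nat (Poly_Mapping.lookup m i + 1) * Poly_Mapping.lookup F (m + Poly_Mapping.single i 1)"
proof -
  let ?e = "Poly_Mapping.single i (1::nat)"
  let ?m = "m + ?e"
  have eq: "x = ?m" if "x - ?e = m" "Poly_Mapping.lookup x i \<noteq> 0" for x
  proof (rule poly_mapping_eqI)
    fix k
    have "Poly_Mapping.lookup (x - ?e) k = Poly_Mapping.lookup m k"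
      using that by simp
    then show "Poly_Mapping.lookup x k = Poly_Mapping.lookup ?m k"
      using that(2) by (auto simp: lookup_minus lookup_add lookup_single when_def split: if_splits)
  qed
  have "Poly_Mapping.lookup (pdiff i F) m = (\<Sum>x\<in>Poly_Mapping.keys F.
      (of_nat (Poly_Mapping.lookup x i) * Poly_Mapping.lookup F x when x - ?e = m))"
    by (simp add: pdiff_def lookup_sum lookup_single)
  also have "\<dots> = (\<Sum>x\<in>Poly_Mapping.keys F.
      if x = ?m then of_nat (Poly_Mapping.lookup ?m i) * Poly_Mapping.lookup F ?m else 0)"
  proof (rule sum.cong[OF refl])
    fix x
    show "(of_nat (Poly_Mapping.lookup x i) * Poly_Mapping.lookup F x when x - ?e = m) =
        (if x = ?m then of_nat (Poly_Mapping.lookup ?m i) * Poly_Mapping.lookup F ?m else 0)"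
    proof (cases "x = ?m")
      case True
      then show ?thesis by simp
    next
      case False
      then have "of_nat (Poly_Mapping.lookup x i) = (0::'k)" if "x - ?e = m"
        using eq[OF that] False by (metis of_nat_0)
      with False show ?thesis by (simp only: when_def if_False mult_zero_left split: if_split) simp
    qed
  qed
  also have "\<dots> = of_nat (Poly_Mapping.lookup ?m i) * Poly_Mapping.lookup F ?m"
    by (simp add: in_keys_iff)
  finally show ?thesis
    by (simp add: lookup_add)
qed

lemma pdiff_commute:
  fixes F :: "('n, 'k::comm_semiring_1) mpoly"
  shows "pdiff i (pdiff j F) = pdiff j (pdiff i F)"
proof (cases "i = j")
  case False
  have "m + Poly_Mapping.single i 1 + Poly_Mapping.single j 1 =
      m + Poly_Mapping.single j 1 + Poly_Mapping.single i (1::nat)" for m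
    by (simp only: ac_simps)
  with False show ?thesis
    by (intro poly_mapping_eqI)
       (simp add: lookup_pdiff lookup_add lookup_single mult.left_commute del: of_nat_Suc of_nat_add)
qed simp

lemma pdiff_comp_fun_commute:
  "comp_fun_commute (\<lambda>i. pdiff i ^^ e i :: ('n, 'k::comm_semiring_1) mpoly \<Rightarrow> _)"
proof
  have one: "pdiff j ((pdiff i ^^ a) F) = (pdiff i ^^ a) (pdiff j F)"
    for i j a and F :: "('n, 'k) mpoly"
    by (induction a) (simp_all add: pdiff_commute[of j i])
  have "(pdiff j ^^ b) ((pdiff i ^^ a) F) = (pdiff i ^^ a) ((pdiff j ^^ b) F)"
    for i j a b and F :: "('n, 'k) mpoly"
    by (induction b) (simp_all add: one)
  then show "(pdiff y ^^ e y) \<circ> (pdiff x ^^ e x) =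
      ((pdiff x ^^ e x) \<circ> (pdiff y ^^ e y) :: ('n, 'k) mpoly \<Rightarrow> _)" for x y
    by (simp add: fun_eq_iff)
qed

section \<open>The graded algebra with a given Macaulay dual generator\<close>

definition mpoly_ring :: "('n, 'k::comm_ring_1) mpoly ring" where
  "mpoly_ring = \<lparr>carrier = UNIV, monoid.mult = (*), one = 1, zero = 0, add = (+)\<rparr>"

definition alg :: "('n, 'k::comm_ring_1) mpoly \<Rightarrow> ('n, 'k) mpoly set ring" where
  "alg F = mpoly_ring Quot ann F"

definition cls :: "('n, 'k::comm_ring_1) mpoly \<Rightarrow> ('n, 'k) mpoly \<Rightarrow> ('n, 'k) mpoly set" where
  "cls F p = ann F +>\<^bsub>mpoly_ring\<^esub> p"

text \<open>The library's linear algebra inside a ring works over a subfield of that ring, here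
  the image of the field of coefficients.\<close>

definition scalars :: "('n, 'k::comm_ring_1) mpoly \<Rightarrow> ('n, 'k) mpoly set set" where
  "scalars F = range (\<lambda>c. cls F (mconst c))"

definition graded_part :: "('n, 'k::comm_ring_1) mpoly \<Rightarrow> nat \<Rightarrow> ('n, 'k) mpoly set set" where
  "graded_part F i = cls F ` hom_part i"

definition h_vec :: "('n, 'k::comm_ring_1) mpoly \<Rightarrow> nat \<Rightarrow> nat" where
  "h_vec F i = ring.dim (alg F) (scalars F) (graded_part F i)"

text \<open>\<open>\<alpha>\<^sub>i = h\<^sub>i - h\<^bsub>i-1\<^esub>\<close> with the convention \<open>h\<^bsub>-1\<^esub> = 0\<close>\<close>

definition h_diff :: "('n, 'k::comm_ring_1) mpoly \<Rightarrow> nat \<Rightarrow> int" where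
  "h_diff F i = int (h_vec F i) - (if i = 0 then 0 else int (h_vec F (i - 1)))"

definition is_basis ::
  "('n, 'k::comm_ring_1) mpoly \<Rightarrow> ('n, 'k) mpoly set list \<Rightarrow> ('n, 'k) mpoly set set \<Rightarrow> bool" where
  "is_basis F Us V \<longleftrightarrow>
     ring.independent (alg F) (scalars F) Us \<and> ring.Span (alg F) (scalars F) Us = V"

definition lincomb ::
  "('n, 'k::comm_ring_1) mpoly \<Rightarrow> (nat \<Rightarrow> 'k) \<Rightarrow> ('n, 'k) mpoly set list \<Rightarrow> ('n, 'k) mpoly set" where
  "lincomb F c Us =
     ring.combine (alg F) (map (\<lambda>i. cls F (mconst (c i))) [0..<length Us]) Us"

section \<open>Zariski topology on affine spaces\<close>

text \<open>The affine space \<open>K\<^sup>I\<close> is the set of functions on \<open>I\<close>, extended by \<^const>\<open>undefined\<close>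
  outside \<open>I\<close>; open sets are complements of zero loci of sets of polynomials in the
  variables indexed by \<open>I\<close>.\<close>

definition zariski_open :: "'i set \<Rightarrow> ('i \<Rightarrow> 'k::comm_ring_1) set \<Rightarrow> bool" where
  "zariski_open I U \<longleftrightarrow> (\<exists>P :: ('i, 'k) mpoly set.
     (\<forall>p\<in>P. \<forall>m\<in>Poly_Mapping.keys p. Poly_Mapping.keys m \<subseteq> I) \<and>
     U = {a \<in> I \<rightarrow>\<^sub>E UNIV. \<exists>p\<in>P. mpoly_eval p a \<noteq> 0})"

definition zariski_dense :: "'i set \<Rightarrow> ('i \<Rightarrow> 'k::comm_ring_1) set \<Rightarrow> bool" where
  "zariski_dense I U \<longleftrightarrow> (\<forall>V. zariski_open I V \<and> V \<noteq> {} \<longrightarrow> U \<inter> V \<noteq> {})"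

text \<open>The Zariski topology on the vector space \<open>[A]\<^sub>1\<close> is read off in the coordinates of a
  basis; it does not depend on the basis, since linear changes of coordinates are
  homeomorphisms.\<close>

definition dense_open_linear_forms ::
  "('n, 'k::comm_ring_1) mpoly \<Rightarrow> ('n, 'k) mpoly set set \<Rightarrow> bool" where
  "dense_open_linear_forms F W \<longleftrightarrow> (\<exists>Us U. is_basis F Us (graded_part F 1) \<and>
     zariski_open {..<length Us} U \<and> zariski_dense {..<length Us} U \<and>
     W = (\<lambda>c. lincomb F c Us) ` U)"

section \<open>Jordan types\<close>

text \<open>\<open>P\<close> is the partition (as a multiset of parts) given by the block sizes in the Jordan
  normal form, with the single eigenvalue 0, of the matrix of multiplication by \<open>l\<close> in a basis
  of the algebra. Matrices in different bases are similar and the block sizes are invariant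
  under similarity, so there is at most one such \<open>P\<close>.\<close>

definition has_jordan_type ::
  "('n, 'k::field) mpoly \<Rightarrow> ('n, 'k) mpoly set \<Rightarrow> nat multiset \<Rightarrow> bool" where
  "has_jordan_type F l P \<longleftrightarrow> (\<exists>Us M ps.
     is_basis F Us (carrier (alg F)) \<and>
     M \<in> carrier_mat (length Us) (length Us) \<and>
     (\<forall>j<length Us. l \<otimes>\<^bsub>alg F\<^esub> (Us ! j) = lincomb F (\<lambda>i. M $$ (i, j)) Us) \<and>
     jordan_nf M (map (\<lambda>p. (p, 0)) ps) \<and>
     P = mset ps)"

definition has_generic_linear_jordan_type ::
  "('n, 'k::field) mpoly \<Rightarrow> nat multiset \<Rightarrow> bool" where
  "has_generic_linear_jordan_type F P \<longleftrightarrow>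
     (\<exists>W. dense_open_linear_forms F W \<and> (\<forall>l\<in>W. has_jordan_type F l P))"

end

theory Submission
  imports Defs
begin

text \<open>
  Write \<open>a\<^sub>k\<close> for the coefficient vector of \<open>\<ell>\<^sub>k\<close>, let \<open>\<psi>\<close> send a polynomial to the sum of the values of its
  degree \<open>d\<close> part at \<open>a\<^sub>1, \<dots>, a\<^sub>s\<close>, and write \<open>A\<close> for the algebra and \<open>R\<^sub>e\<close>, \<open>A\<^sub>e\<close> for the homogeneous
  parts of degree \<open>e\<close>. By Macaulay duality the annihilator of \<open>F\<^sub>s\<close> is the radical of the pairing
  \<open>(p, q) \<mapsto> \<psi> (p * q)\<close> (\<open>ann_power_sum_iff\<close>), so all questions about \<open>A\<close> become questions about
  bilinear forms given by evaluation at points.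

  For a linear form \<open>l\<close> and \<open>e \<le> d div 2\<close> consider the symmetric form
  \<open>B\<^sub>e(p, q) = \<psi> (l ^ (d - 2 * e) * (p * q))\<close> on \<open>R\<^sub>e\<close>, which is the sum of
  \<open>l(a\<^sub>k) ^ (d - 2 * e) * p(a\<^sub>k) * q(a\<^sub>k)\<close> over \<open>k\<close>. It factors both through \<open>R\<^sub>e\<close> and through the \<open>s\<close>
  evaluations, so its rank is at most \<open>q\<^sub>e = min s (dim R\<^sub>e)\<close>. If the rank is \<open>q\<^sub>e\<close>, then \<open>h\<^sub>e = q\<^sub>e\<close> and \<open>B\<^sub>e\<close> is
  nondegenerate on \<open>A\<^sub>e\<close> (\<open>gram_det_imp_basis\<close>): the element \<open>l\<close> is strong Lefschetz. Having rank \<open>q\<^sub>e\<close>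
  means that some Gram determinant does not vanish, an open condition on the points and on \<open>l\<close>. For
  each \<open>e\<close> it holds for \<open>l = x\<^sub>1 + \<dots> + x\<^sub>n\<close> when the nonzero points are lattice points of a simplex,
  where interpolating products of linear forms make the Gram matrix diagonal (\<open>gram_det_witness\<close>). The
  dense open set of points is the one on which this particular \<open>l\<close> works. For each fixed choice of
  points in it, the linear forms that work again form an open set, nonempty because it contains the
  class of \<open>x\<^sub>1 + \<dots> + x\<^sub>n\<close>. Both sets are dense since affine space is irreducible.

  Suppose all \<open>B\<^sub>e\<close> are nondegenerate. The primitive elements of degree \<open>e\<close>, those killed by
  \<open>l ^ (d + 1 - 2 * e)\<close>, form the orthogonal complement of \<open>l * A\<^bsub>e-1\<^esub>\<close> in \<open>A\<^sub>e\<close>. Choose an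
  orthogonal basis \<open>v\<^bsub>e,0\<^esub>, v\<^bsub>e,1\<^esub>, \<dots>\<close> of them. The products \<open>l ^ k * v\<^bsub>e,j\<^esub>\<close> with \<open>k \<le> d - 2 * e\<close> are
  strings for multiplication by \<open>l\<close>. Up to scalars, reversing every string gives the dual family for
  the pairing (\<open>string_pairing\<close>), whence the products are independent, and induction on the degree
  shows that they span. So they form a Jordan basis in which exactly \<open>h\<^sub>e - h\<^bsub>e-1\<^esub>\<close> blocks have size
  \<open>d + 1 - 2 * e\<close>. As \<open>h\<^sub>e = s\<close> for \<open>r \<le> e \<le> d div 2\<close>, no string starts in a degree above \<open>m\<close>.
\<close>

section \<open>Evaluation of polynomials\<close>

definition mdeg :: "('n \<Rightarrow>\<^sub>0 nat) \<Rightarrow> nat" where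
  "mdeg m = (\<Sum>j\<in>Poly_Mapping.keys m. Poly_Mapping.lookup m j)"

definition mval :: "('n \<Rightarrow>\<^sub>0 nat) \<Rightarrow> ('n \<Rightarrow> 'k::comm_semiring_1) \<Rightarrow> 'k" where
  "mval m a = (\<Prod>i\<in>Poly_Mapping.keys m. a i ^ Poly_Mapping.lookup m i)"

lemma mdeg_superset:
  assumes "finite J" "Poly_Mapping.keys m \<subseteq> J"
  shows "mdeg m = (\<Sum>j\<in>J. Poly_Mapping.lookup m j)"
  unfolding mdeg_def by (rule sum.mono_neutral_left) (use assms in \<open>auto simp: in_keys_iff\<close>)

lemma mval_superset:
  assumes "finite J" "Poly_Mapping.keys m \<subseteq> J"
  shows "mval m a = (\<Prod>j\<in>J. a j ^ Poly_Mapping.lookup m j)"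
  unfolding mval_def by (rule prod.mono_neutral_left) (use assms in \<open>auto simp: in_keys_iff\<close>)

lemma mdeg_add: "mdeg (m + m') = mdeg m + mdeg m'"
proof -
  let ?J = "Poly_Mapping.keys m \<union> Poly_Mapping.keys m'"
  have "mdeg (m + m') = (\<Sum>j\<in>?J. Poly_Mapping.lookup (m + m') j)"
    by (rule mdeg_superset) (use keys_add[of m m'] in auto)
  also have "\<dots> = mdeg m + mdeg m'"
    by (simp add: lookup_add sum.distrib mdeg_superset[of ?J])
  finally show ?thesis .
qed

lemma mval_add: "mval (m + m') a = mval m a * mval m' a"
proof -
  let ?J = "Poly_Mapping.keys m \<union> Poly_Mapping.keys m'"
  have "mval (m + m') a = (\<Prod>j\<in>?J. a j ^ Poly_Mapping.lookup (m + m') j)"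
    by (rule mval_superset) (use keys_add[of m m'] in auto)
  also have "\<dots> = mval m a * mval m' a"
    by (simp add: lookup_add prod.distrib power_add mval_superset[of ?J])
  finally show ?thesis .
qed

lemma mdeg_zero [simp]: "mdeg 0 = 0" and mval_zero [simp]: "mval 0 a = 1"
  by (simp_all add: mdeg_def mval_def)

lemma mdeg_single [simp]: "mdeg (Poly_Mapping.single j c) = c"
  by (cases "c = 0") (simp_all add: mdeg_def)

lemma mval_single [simp]: "mval (Poly_Mapping.single j c) a = a j ^ c"
  by (cases "c = 0") (simp_all add: mval_def)

lemma hom_part_iff:
  "p \<in> hom_part i \<longleftrightarrow> (\<forall>m. Poly_Mapping.lookup p m \<noteq> 0 \<longrightarrow> mdeg m = i)"
  by (auto simp: hom_part_def mdeg_def in_keys_iff)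

lemma keys_sum_single:
  fixes p :: "'a \<Rightarrow>\<^sub>0 'b::comm_monoid_add"
  shows "p = (\<Sum>m\<in>Poly_Mapping.keys p. Poly_Mapping.single m (Poly_Mapping.lookup p m))"
  by (rule poly_mapping_eqI) (simp add: lookup_sum lookup_single when_def in_keys_iff)

lemma poly_mapping_sum_induct [case_names zero add]:
  fixes p :: "'a \<Rightarrow>\<^sub>0 'b::comm_monoid_add"
  assumes "P 0" "\<And>m c q. P q \<Longrightarrow> P (Poly_Mapping.single m c + q)"
  shows "P p"
proof -
  have "P (\<Sum>m\<in>A. Poly_Mapping.single m (Poly_Mapping.lookup p m))" if "finite A" for A
    using that by induction (simp_all add: assms)
  then show ?thesis
    using keys_sum_single[of p] by (metis finite_keys)
qed

lemma mpoly_eval_superset: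
  assumes "finite J" "Poly_Mapping.keys p \<subseteq> J"
  shows "mpoly_eval p a = (\<Sum>m\<in>J. Poly_Mapping.lookup p m * mval m a)"
  unfolding mpoly_eval_def mval_def[symmetric]
  by (rule sum.mono_neutral_left) (use assms in \<open>auto simp: in_keys_iff\<close>)

lemma mpoly_eval_zero [simp]: "mpoly_eval 0 a = 0"
  by (simp add: mpoly_eval_def)

lemma mpoly_eval_single [simp]: "mpoly_eval (Poly_Mapping.single m c) a = c * mval m a"
  by (cases "c = 0") (simp_all add: mpoly_eval_def mval_def)

lemma mpoly_eval_const [simp]: "mpoly_eval (mconst c) a = c"
  by (simp add: mconst_def)

lemma mpoly_eval_one [simp]: "mpoly_eval 1 a = 1"
  using mpoly_eval_single[of 0 1 a] by simp

lemma mpoly_eval_add [simp]: "mpoly_eval (p + q) a = mpoly_eval p a + mpoly_eval q a"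
proof -
  let ?J = "Poly_Mapping.keys p \<union> Poly_Mapping.keys q"
  have "mpoly_eval (p + q) a = (\<Sum>m\<in>?J. Poly_Mapping.lookup (p + q) m * mval m a)"
    by (rule mpoly_eval_superset) (use keys_add[of p q] in auto)
  also have "\<dots> = mpoly_eval p a + mpoly_eval q a"
    by (simp add: lookup_add sum.distrib algebra_simps mpoly_eval_superset[of ?J])
  finally show ?thesis .
qed

lemma mpoly_eval_mult [simp]: "mpoly_eval (p * q) a = mpoly_eval p a * mpoly_eval q a"
proof -
  have single: "mpoly_eval (Poly_Mapping.single m c * q) a = c * mval m a * mpoly_eval q a" for m c
    by (induction q rule: poly_mapping_sum_induct)
      (simp_all add: algebra_simps mult_single mval_add)
  show ?thesis
    by (induction p rule: poly_mapping_sum_induct) (simp_all add: distrib_right single)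
qed

lemma mpoly_eval_sum [simp]: "mpoly_eval (sum f A) a = (\<Sum>x\<in>A. mpoly_eval (f x) a)"
  by (induction A rule: infinite_finite_induct) simp_all

lemma mpoly_eval_prod [simp]: "mpoly_eval (prod f A) a = (\<Prod>x\<in>A. mpoly_eval (f x) a)"
  by (induction A rule: infinite_finite_induct) simp_all

lemma mpoly_eval_power [simp]: "mpoly_eval (p ^ n) a = mpoly_eval p a ^ n"
  by (induction n) simp_all

lemma mpoly_eval_lin_form [simp]: "mpoly_eval (lin_form c) a = (\<Sum>j\<in>UNIV. c j * a j)"
  by (simp add: lin_form_def)

lemma mpoly_eval_cong:
  assumes "\<forall>m\<in>Poly_Mapping.keys p. Poly_Mapping.keys m \<subseteq> I" "\<And>i. i \<in> I \<Longrightarrow> a i = b i"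
  shows "mpoly_eval p a = mpoly_eval p b"
  unfolding mpoly_eval_def
  using assms by (intro sum.cong refl arg_cong2[of _ _ _ _ "(*)"] prod.cong) (auto simp: subset_iff)

lemma mval_origin: "mval m (\<lambda>_. 0) = (0 ^ mdeg m :: 'k::comm_semiring_1)"
  by (simp add: mval_def mdeg_def power_sum)

lemma mpoly_eval_origin:
  assumes "p \<in> hom_part i" "i > 0"
  shows "mpoly_eval p (\<lambda>_. 0) = 0"
  unfolding mpoly_eval_def mval_def[symmetric]
  using assms by (intro sum.neutral) (auto simp: hom_part_iff in_keys_iff mval_origin zero_power)

section \<open>Homogeneous polynomials\<close>

lemma hom_part_zero [simp]: "0 \<in> hom_part i"
  by (simp add: hom_part_iff)

lemma hom_part_single: "mdeg m = i \<Longrightarrow> Poly_Mapping.single m c \<in> hom_part i"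
  by (simp add: hom_part_iff lookup_single when_def)

lemma hom_part_const [simp]: "mconst c \<in> hom_part 0"
  by (simp add: mconst_def hom_part_single)

lemma hom_part_one [simp]: "1 \<in> hom_part 0"
  by (metis hom_part_const mconst_def single_one)

lemma hom_part_add: "p \<in> hom_part i \<Longrightarrow> q \<in> hom_part i \<Longrightarrow> p + q \<in> hom_part i"
  by (auto simp: hom_part_iff lookup_add) (metis add.right_neutral)

lemma hom_part_diff:
  fixes p q :: "('n, 'k::ab_group_add) mpoly"
  shows "p \<in> hom_part i \<Longrightarrow> q \<in> hom_part i \<Longrightarrow> p - q \<in> hom_part i"
  by (auto simp: hom_part_iff lookup_minus) (metis diff_zero)

lemma hom_part_sum: "(\<And>x. x \<in> A \<Longrightarrow> f x \<in> hom_part i) \<Longrightarrow> sum f A \<in> hom_part i"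
  by (induction A rule: infinite_finite_induct) (simp_all add: hom_part_add)

lemma hom_part_mult:
  fixes p q :: "('n, 'k::comm_semiring_1) mpoly"
  assumes "p \<in> hom_part i" "q \<in> hom_part j"
  shows "p * q \<in> hom_part (i + j)"
  using keys_mult[of p q] assms unfolding hom_part_def
  by (fastforce simp: mdeg_def[symmetric] mdeg_add)

lemma hom_part_scale:
  fixes p :: "('n, 'k::comm_semiring_1) mpoly"
  shows "p \<in> hom_part i \<Longrightarrow> mconst c * p \<in> hom_part i"
  using hom_part_mult[OF hom_part_const] by fastforce

lemma hom_part_power:
  fixes p :: "('n, 'k::comm_semiring_1) mpoly"
  assumes "p \<in> hom_part i"
  shows "p ^ e \<in> hom_part (e * i)"
  by (induction e) (use hom_part_mult[OF assms] in auto)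

lemma hom_part_prod:
  fixes f :: "'a \<Rightarrow> ('n, 'k::comm_semiring_1) mpoly"
  assumes "\<And>x. x \<in> A \<Longrightarrow> f x \<in> hom_part (e x)"
  shows "prod f A \<in> hom_part (sum e A)"
  using assms by (induction A rule: infinite_finite_induct) (auto simp: hom_part_mult)

lemma hom_part_lin_form: "lin_form c \<in> hom_part 1"
  unfolding lin_form_def by (intro hom_part_sum hom_part_single) simp

lemma mconst_zero [simp]: "mconst 0 = 0"
  and mconst_one [simp]: "mconst 1 = 1"
  and mconst_add: "mconst (b + c) = mconst b + mconst c"
  by (simp_all add: mconst_def single_add)

lemma mconst_mult: "mconst (b * c) = (mconst b * mconst c :: ('n, 'k::comm_semiring_1) mpoly)"
  by (simp add: mconst_def mult_single)

lemma mconst_minus: "mconst (- c) = (- mconst c :: ('n, 'k::comm_ring_1) mpoly)"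
  by (simp add: mconst_def single_uminus)

lemma lookup_mconst_mult [simp]:
  fixes G :: "('n, 'k::comm_semiring_1) mpoly"
  shows "Poly_Mapping.lookup (mconst c * G) k = c * Poly_Mapping.lookup G k"
  by (induction G rule: poly_mapping_sum_induct)
    (simp_all add: mconst_def algebra_simps mult_single lookup_add lookup_single when_def)

section \<open>Zariski open sets\<close>

text \<open>Restrictions of polynomials in the variables indexed by \<open>I\<close>. Working with the functions rather than
  with the polynomials lets openness be read off from closure properties.\<close>

definition regular_fun :: "'i set \<Rightarrow> (('i \<Rightarrow> 'k::comm_ring_1) \<Rightarrow> 'k) \<Rightarrow> bool" where
  "regular_fun I f \<longleftrightarrow> (\<exists>p :: ('i, 'k) mpoly.
     (\<forall>m\<in>Poly_Mapping.keys p. Poly_Mapping.keys m \<subseteq> I) \<and> (\<forall>a. f a = mpoly_eval p a))"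

lemma regular_fun_const: "regular_fun I (\<lambda>_. c)"
proof -
  have "\<forall>m\<in>Poly_Mapping.keys (mconst c :: ('a, 'b) mpoly). Poly_Mapping.keys m \<subseteq> I"
    by (cases "c = 0") (simp_all add: mconst_def)
  then show ?thesis
    unfolding regular_fun_def by (metis mpoly_eval_const)
qed

lemma regular_fun_var: "i \<in> I \<Longrightarrow> regular_fun I (\<lambda>a. a i)"
  unfolding regular_fun_def
  by (rule exI[of _ "Poly_Mapping.single (Poly_Mapping.single i 1) 1"]) simp

lemma regular_fun_add:
  assumes "regular_fun I f" "regular_fun I g"
  shows "regular_fun I (\<lambda>a. f a + g a)"
proof -
  obtain p q where "\<forall>m\<in>Poly_Mapping.keys p. Poly_Mapping.keys m \<subseteq> I" "\<forall>a. f a = mpoly_eval p a"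
    "\<forall>m\<in>Poly_Mapping.keys q. Poly_Mapping.keys m \<subseteq> I" "\<forall>a. g a = mpoly_eval q a"
    using assms unfolding regular_fun_def by blast
  moreover have "\<forall>m\<in>Poly_Mapping.keys (p + q). Poly_Mapping.keys m \<subseteq> I"
    using calculation keys_add[of p q] by blast
  ultimately show ?thesis
    unfolding regular_fun_def by (intro exI[of _ "p + q"]) simp
qed

lemma regular_fun_mult:
  assumes "regular_fun I f" "regular_fun I g"
  shows "regular_fun I (\<lambda>a. f a * g a)"
proof -
  obtain p q where pq: "\<forall>m\<in>Poly_Mapping.keys p. Poly_Mapping.keys m \<subseteq> I" "\<forall>a. f a = mpoly_eval p a"
    "\<forall>m\<in>Poly_Mapping.keys q. Poly_Mapping.keys m \<subseteq> I" "\<forall>a. g a = mpoly_eval q a"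
    using assms unfolding regular_fun_def by blast
  have "Poly_Mapping.keys m \<subseteq> I" if m: "m \<in> Poly_Mapping.keys (p * q)" for m
  proof -
    obtain x y where "m = x + y" "x \<in> Poly_Mapping.keys p" "y \<in> Poly_Mapping.keys q"
      using keys_mult[of p q] m by blast
    then show ?thesis
      using pq keys_add[of x y] by blast
  qed
  with pq show ?thesis
    unfolding regular_fun_def by (intro exI[of _ "p * q"]) auto
qed

lemma regular_fun_sum:
  "(\<And>x. x \<in> A \<Longrightarrow> regular_fun I (f x)) \<Longrightarrow> regular_fun I (\<lambda>a. \<Sum>x\<in>A. f x a)"
  by (induction A rule: infinite_finite_induct) (simp_all add: regular_fun_const regular_fun_add)

lemma regular_fun_prod:
  "(\<And>x. x \<in> A \<Longrightarrow> regular_fun I (f x)) \<Longrightarrow> regular_fun I (\<lambda>a. \<Prod>x\<in>A. f x a)"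
  by (induction A rule: infinite_finite_induct) (simp_all add: regular_fun_const regular_fun_mult)

lemma regular_fun_power: "regular_fun I f \<Longrightarrow> regular_fun I (\<lambda>a. f a ^ n)"
  by (induction n) (simp_all add: regular_fun_const regular_fun_mult)

text \<open>Coefficients of \<open>p\<close> stay fixed here; only the point at which \<open>p\<close> is evaluated varies.\<close>

lemma regular_fun_mpoly_eval:
  assumes "\<And>i. regular_fun I (\<lambda>a. g a i)"
  shows "regular_fun I (\<lambda>a. mpoly_eval p (g a))"
  unfolding mpoly_eval_def
  by (intro regular_fun_sum regular_fun_mult regular_fun_const regular_fun_prod regular_fun_power assms)

lemma regular_fun_det:
  assumes "\<And>i j. i < n \<Longrightarrow> j < n \<Longrightarrow> regular_fun I (\<lambda>a. f a (i, j))"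
  shows "regular_fun I (\<lambda>a. det (mat n n (f a)))"
proof -
  have less: "p i < n" if "p permutes {0..<n}" "i < n" for p i
    using permutes_in_image[OF that(1), of i] that(2) by simp
  have "det (mat n n (f a)) = (\<Sum>p\<in>{p. p permutes {0..<n}}.
      signof p * (\<Prod>i\<in>{0..<n}. f a (i, p i)))" for a
    unfolding det_def
    by (auto intro!: sum.cong arg_cong2[of _ _ _ _ "(*)"] prod.cong simp: less)
  moreover have "regular_fun I (\<lambda>a. \<Sum>p\<in>{p. p permutes {0..<n}}.
      signof p * (\<Prod>i\<in>{0..<n}. f a (i, p i)))"
    by (intro regular_fun_sum regular_fun_mult regular_fun_const regular_fun_prod assms)
       (auto simp: less)
  ultimately show ?thesis by simp
qed

lemma zariski_open_regular_funs:
  assumes "\<And>f. f \<in> T \<Longrightarrow> regular_fun I f"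
  shows "zariski_open I {a \<in> I \<rightarrow>\<^sub>E UNIV. \<exists>f\<in>T. f a \<noteq> 0}"
  unfolding zariski_open_def
proof (rule exI[of _ "{p. (\<forall>m\<in>Poly_Mapping.keys p. Poly_Mapping.keys m \<subseteq> I) \<and>
    (\<exists>f\<in>T. \<forall>a. f a = mpoly_eval p a)}"], rule conjI)
  show "{a \<in> I \<rightarrow>\<^sub>E UNIV. \<exists>f\<in>T. f a \<noteq> 0} = {a \<in> I \<rightarrow>\<^sub>E UNIV.
     \<exists>p\<in>{p. (\<forall>m\<in>Poly_Mapping.keys p. Poly_Mapping.keys m \<subseteq> I) \<and>
    (\<exists>f\<in>T. \<forall>a. f a = mpoly_eval p a)}. mpoly_eval p a \<noteq> 0}"
    using assms unfolding regular_fun_def by (intro Collect_cong conj_cong refl iffI) (clarsimp, metis)+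
qed auto

lemma zariski_openD:
  assumes "zariski_open I U"
  obtains T where "\<And>f. f \<in> T \<Longrightarrow> regular_fun I f" "U = {a \<in> I \<rightarrow>\<^sub>E UNIV. \<exists>f\<in>T. f a \<noteq> 0}"
proof -
  obtain P where P: "\<forall>p\<in>P. \<forall>m\<in>Poly_Mapping.keys p. Poly_Mapping.keys m \<subseteq> I"
    and U: "U = {a \<in> I \<rightarrow>\<^sub>E UNIV. \<exists>p\<in>P. mpoly_eval p a \<noteq> 0}"
    using assms unfolding zariski_open_def by blast
  show ?thesis
  proof (rule that[of "mpoly_eval ` P"])
    show "regular_fun I f" if "f \<in> mpoly_eval ` P" for f
      using that P unfolding regular_fun_def by blast
    show "U = {a \<in> I \<rightarrow>\<^sub>E UNIV. \<exists>f\<in>mpoly_eval ` P. f a \<noteq> 0}"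
      unfolding U by simp
  qed
qed

lemma zariski_open_Int:
  assumes "zariski_open I U" "zariski_open I V"
  shows "zariski_open I (U \<inter> (V :: ('i \<Rightarrow> 'k::idom) set))"
proof -
  obtain S where S: "\<And>f. f \<in> S \<Longrightarrow> regular_fun I f" "U = {a \<in> I \<rightarrow>\<^sub>E UNIV. \<exists>f\<in>S. f a \<noteq> 0}"
    by (rule zariski_openD[OF assms(1)]) blast
  obtain T where T: "\<And>f. f \<in> T \<Longrightarrow> regular_fun I f" "V = {a \<in> I \<rightarrow>\<^sub>E UNIV. \<exists>f\<in>T. f a \<noteq> 0}"
    by (rule zariski_openD[OF assms(2)]) blast
  have "U \<inter> V = {a \<in> I \<rightarrow>\<^sub>E UNIV. \<exists>h\<in>(\<lambda>(f, g) a. f a * g a) ` (S \<times> T). h a \<noteq> 0}"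
    unfolding S T by auto
  moreover have "zariski_open I \<dots>"
    by (rule zariski_open_regular_funs) (use S(1) T(1) in \<open>auto intro: regular_fun_mult\<close>)
  ultimately show ?thesis by simp
qed

lemma regular_fun_line:
  assumes "regular_fun I f"
  obtains P where "\<And>t. poly P t = f (\<lambda>i. if i \<in> I then a i + t * (b i - a i) else undefined)"
proof -
  obtain p where p: "\<forall>m\<in>Poly_Mapping.keys p. Poly_Mapping.keys m \<subseteq> I" "\<And>a. f a = mpoly_eval p a"
    using assms unfolding regular_fun_def by blast
  show ?thesis
  proof (rule that)
    fix t
    have "poly (\<Sum>m\<in>Poly_Mapping.keys p. [:Poly_Mapping.lookup p m:] *
        (\<Prod>i\<in>Poly_Mapping.keys m. [:a i, b i - a i:] ^ Poly_Mapping.lookup m i)) t =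
        mpoly_eval p (\<lambda>i. a i + t * (b i - a i))"
      by (simp add: mpoly_eval_def poly_sum poly_prod algebra_simps)
    also have "\<dots> = f (\<lambda>i. if i \<in> I then a i + t * (b i - a i) else undefined)"
      unfolding p(2) by (rule mpoly_eval_cong[OF p(1)]) simp
    finally show "poly (\<Sum>m\<in>Poly_Mapping.keys p. [:Poly_Mapping.lookup p m:] *
        (\<Prod>i\<in>Poly_Mapping.keys m. [:a i, b i - a i:] ^ Poly_Mapping.lookup m i)) t =
        f (\<lambda>i. if i \<in> I then a i + t * (b i - a i) else undefined)" .
  qed
qed

text \<open>On the line joining a point of one nonempty open set to a point of another one, each of the two
  regular functions involved is a nonzero polynomial in one variable, and together these have only
  finitely many zeros, while the field is infinite.\<close>

lemma zariski_open_irreducible: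
  fixes U V :: "('i \<Rightarrow> 'k::field_char_0) set"
  assumes "zariski_open I U" "zariski_open I V" "U \<noteq> {}" "V \<noteq> {}"
  shows "U \<inter> V \<noteq> {}"
proof -
  obtain S where S: "\<And>f. f \<in> S \<Longrightarrow> regular_fun I f" "U = {a \<in> I \<rightarrow>\<^sub>E UNIV. \<exists>f\<in>S. f a \<noteq> 0}"
    by (rule zariski_openD[OF assms(1)]) blast
  obtain T where T: "\<And>f. f \<in> T \<Longrightarrow> regular_fun I f" "V = {a \<in> I \<rightarrow>\<^sub>E UNIV. \<exists>f\<in>T. f a \<noteq> 0}"
    by (rule zariski_openD[OF assms(2)]) blast
  obtain a f where a: "a \<in> I \<rightarrow>\<^sub>E UNIV" "f \<in> S" "f a \<noteq> 0"
    using assms(3) unfolding S by blast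
  obtain b g where b: "b \<in> I \<rightarrow>\<^sub>E UNIV" "g \<in> T" "g b \<noteq> 0"
    using assms(4) unfolding T by blast
  define c where "c t = (\<lambda>i. if i \<in> I then a i + t * (b i - a i) else undefined)" for t
  have c: "c t \<in> I \<rightarrow>\<^sub>E UNIV" for t
    unfolding c_def by auto
  have c01: "c 0 = a" "c 1 = b"
    by (auto simp: c_def fun_eq_iff PiE_arb[OF a(1)] PiE_arb[OF b(1)])
  obtain P where P: "\<And>t. poly P t = f (c t)"
    using regular_fun_line[OF S(1)[OF a(2)]] unfolding c_def by metis
  obtain Q where Q: "\<And>t. poly Q t = g (c t)"
    using regular_fun_line[OF T(1)[OF b(2)]] unfolding c_def by metis
  have "P \<noteq> 0" "Q \<noteq> 0"
    using P[of 0] Q[of 1] a b by (auto simp: c01)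
  then have "P * Q \<noteq> 0" by simp
  then have "finite {t. poly (P * Q) t = 0}"
    by (rule poly_roots_finite)
  from ex_new_if_finite[OF infinite_UNIV_char_0 this] obtain t where "poly (P * Q) t \<noteq> 0"
    by blast
  then have "f (c t) \<noteq> 0" "g (c t) \<noteq> 0"
    using P Q by auto
  then show ?thesis
    using a b c unfolding S T by blast
qed

corollary zariski_dense_open:
  fixes U :: "('i \<Rightarrow> 'k::field_char_0) set"
  assumes "zariski_open I U" "U \<noteq> {}"
  shows "zariski_dense I U"
  unfolding zariski_dense_def using zariski_open_irreducible assms by blast

lemma zariski_open_UNIV: "zariski_open I (I \<rightarrow>\<^sub>E (UNIV :: 'k::comm_ring_1 set))"
  using zariski_open_regular_funs[of "{\<lambda>_. 1 :: 'k}" I] by (simp add: regular_fun_const)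

lemma zariski_open_INT:
  fixes U :: "'a \<Rightarrow> ('i \<Rightarrow> 'k::field_char_0) set"
  assumes "finite E" "\<And>e. e \<in> E \<Longrightarrow> zariski_open I (U e) \<and> U e \<noteq> {}"
  shows "zariski_open I ((I \<rightarrow>\<^sub>E UNIV) \<inter> (\<Inter>e\<in>E. U e)) \<and> (I \<rightarrow>\<^sub>E UNIV) \<inter> (\<Inter>e\<in>E. U e) \<noteq> {}"
  using assms
proof (induction E)
  case empty
  then show ?case by (simp add: zariski_open_UNIV PiE_eq_empty_iff)
next
  case (insert e E)
  then have "zariski_open I ((I \<rightarrow>\<^sub>E UNIV) \<inter> (\<Inter>e\<in>E. U e))" "(I \<rightarrow>\<^sub>E UNIV) \<inter> (\<Inter>e\<in>E. U e) \<noteq> {}"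
    and "zariski_open I (U e)" "U e \<noteq> {}" by auto
  from zariski_open_Int[OF this(3,1)] zariski_open_irreducible[OF this(3,1,4,2)]
  show ?case by (simp add: Int_left_commute)
qed

section \<open>Differentiation in divided power coordinates\<close>

definition mfact :: "('n::finite \<Rightarrow>\<^sub>0 nat) \<Rightarrow> 'k::field_char_0" where
  "mfact m = (\<Prod>j\<in>UNIV. fact (Poly_Mapping.lookup m j))"

text \<open>Multiplying the coefficient of \<open>X ^ k\<close> by \<open>k!\<close> turns differentiation into a shift of exponents,
  without any numerical factor.\<close>

definition dp_coeff :: "('n::finite, 'k::field_char_0) mpoly \<Rightarrow> ('n \<Rightarrow>\<^sub>0 nat) \<Rightarrow> 'k" where
  "dp_coeff F k = mfact k * Poly_Mapping.lookup F k"

lemma mfact_nonzero: "mfact m \<noteq> (0 :: 'k::field_char_0)"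
  by (simp add: mfact_def)

lemma mfact_add_single:
  "mfact (k + Poly_Mapping.single i 1) =
     of_nat (Poly_Mapping.lookup k i + 1) * (mfact k :: 'k::field_char_0)"
  unfolding mfact_def
  by (subst (1 2) prod.remove[of UNIV i])
    (auto simp: lookup_add lookup_single when_def algebra_simps intro!: prod.cong)

lemma dp_coeff_pdiff:
  "dp_coeff (pdiff i F) k = dp_coeff F (k + Poly_Mapping.single i 1)"
  for F :: "('n::finite, 'k::field_char_0) mpoly"
  by (simp only: dp_coeff_def lookup_pdiff mfact_add_single mult_ac)

lemma dp_coeff_pdiff_power:
  "dp_coeff ((pdiff i ^^ n) F) k = dp_coeff F (k + Poly_Mapping.single i n)"
  for F :: "('n::finite, 'k::field_char_0) mpoly"
proof (induction n arbitrary: k)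
  case (Suc n)
  have "Poly_Mapping.single i 1 + Poly_Mapping.single i n = Poly_Mapping.single i (Suc n)"
    by (simp flip: single_add)
  then show ?case
    by (simp add: dp_coeff_pdiff Suc add.assoc)
qed simp

lemma dp_coeff_pdiff_monom:
  "dp_coeff (pdiff_monom m F) k = dp_coeff F (k + m)"
  for F :: "('n::finite, 'k::field_char_0) mpoly"
proof -
  interpret comp_fun_commute "\<lambda>i. pdiff i ^^ Poly_Mapping.lookup m i :: ('n, 'k) mpoly \<Rightarrow> _"
    by (rule pdiff_comp_fun_commute)
  have "dp_coeff (Finite_Set.fold (\<lambda>i. pdiff i ^^ Poly_Mapping.lookup m i) F A) k =
      dp_coeff F (k + (\<Sum>i\<in>A. Poly_Mapping.single i (Poly_Mapping.lookup m i)))"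
    if "finite A" for A k
    using that by (induction A arbitrary: k) (simp_all add: dp_coeff_pdiff_power add.assoc)
  from this[OF finite_keys, of m] show ?thesis
    unfolding pdiff_monom_def keys_sum_single[of m, symmetric] .
qed

lemma lookup_var_mult:
  "Poly_Mapping.lookup (Poly_Mapping.single (Poly_Mapping.single j 1) c * G) k =
     (if Poly_Mapping.lookup k j = 0 then 0
      else c * Poly_Mapping.lookup G (k - Poly_Mapping.single j 1))"
  for G :: "('n, 'k::comm_semiring_1) mpoly"
proof (induction G rule: poly_mapping_sum_induct)
  case (add m b q)
  have "Poly_Mapping.single j 1 + m = k \<longleftrightarrow>
      Poly_Mapping.lookup k j \<noteq> 0 \<and> m = k - Poly_Mapping.single j 1"
    by (auto simp: lookup_add lookup_minus lookup_single when_def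
        intro!: poly_mapping_eqI split: if_splits)
  with add show ?case
    by (auto simp: distrib_left lookup_add mult_single lookup_single when_def)
qed simp

lemma exponent_split:
  assumes "Poly_Mapping.lookup k j \<noteq> 0"
  shows "(k - Poly_Mapping.single j 1) + Poly_Mapping.single j 1 = (k :: _ \<Rightarrow>\<^sub>0 nat)"
  by (rule poly_mapping_eqI) (use assms in \<open>auto simp: lookup_add lookup_minus lookup_single when_def\<close>)

lemma mdeg_UNIV: "mdeg m = (\<Sum>j\<in>UNIV. Poly_Mapping.lookup m j)" for m :: "'n::finite \<Rightarrow>\<^sub>0 nat"
  by (rule mdeg_superset) auto

text \<open>This is the multinomial theorem: in divided power coordinates the multinomial coefficients cancel,
  and the power of a linear form becomes the evaluation of monomials at its coefficient vector.\<close>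

lemma dp_coeff_lin_form_power:
  fixes a :: "'n::finite \<Rightarrow> 'k::field_char_0"
  shows "dp_coeff (lin_form a ^ d) k = (if mdeg k = d then fact d * mval k a else 0)"
proof (induction d arbitrary: k)
  case 0
  have "mdeg k = 0 \<longleftrightarrow> k = 0"
    by (auto simp: mdeg_UNIV intro!: poly_mapping_eqI)
  then show ?case
    by (simp add: dp_coeff_def lookup_one mfact_def when_def)
next
  case (Suc d)
  have lin_mult: "Poly_Mapping.lookup (lin_form a * G) k =
      (\<Sum>j\<in>UNIV. if Poly_Mapping.lookup k j = 0 then 0
        else a j * Poly_Mapping.lookup G (k - Poly_Mapping.single j 1))" for G
    by (simp only: lin_form_def sum_distrib_right lookup_sum lookup_var_mult)
  have "dp_coeff (lin_form a ^ Suc d) k =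
      (\<Sum>j\<in>UNIV. mfact k * (if Poly_Mapping.lookup k j = 0 then 0
        else a j * Poly_Mapping.lookup (lin_form a ^ d) (k - Poly_Mapping.single j 1)))"
    by (simp only: dp_coeff_def power_Suc lin_mult sum_distrib_left)
  also have "\<dots> = (\<Sum>j\<in>UNIV. of_nat (Poly_Mapping.lookup k j) *
      (if mdeg k = Suc d then fact d * mval k a else 0))"
  proof (rule sum.cong[OF refl])
    fix j
    show "mfact k * (if Poly_Mapping.lookup k j = 0 then 0
        else a j * Poly_Mapping.lookup (lin_form a ^ d) (k - Poly_Mapping.single j 1)) =
      of_nat (Poly_Mapping.lookup k j) * (if mdeg k = Suc d then fact d * mval k a else 0)"
    proof (cases "Poly_Mapping.lookup k j = 0")
      case False
      define k' where "k' = k - Poly_Mapping.single j 1"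
      have k: "k = k' + Poly_Mapping.single j 1"
        using exponent_split[OF False] by (simp add: k'_def)
      have "mfact k * (a j * Poly_Mapping.lookup (lin_form a ^ d) k') =
          of_nat (Poly_Mapping.lookup k j) * (a j * dp_coeff (lin_form a ^ d) k')"
        unfolding k mfact_add_single dp_coeff_def by (simp add: lookup_add algebra_simps)
      also have "a j * dp_coeff (lin_form a ^ d) k' =
          (if mdeg k = Suc d then fact d * mval k a else 0)"
        by (simp add: Suc k mdeg_add mval_add)
      finally show ?thesis
        using False by (simp add: k'_def)
    qed simp
  qed
  also have "\<dots> = (if mdeg k = Suc d then fact (Suc d) * mval k a else 0)"
    by (simp add: mdeg_UNIV flip: sum_distrib_right of_nat_sum)
  finally show ?case .
qed

section \<open>The dual functional of a sum of powers\<close>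

text \<open>On forms of degree \<open>d\<close> this is the sum of the values at the \<open>s\<close> points; on forms of any other degree it
  is zero. Up to the factor \<open>d!\<close> it is \<open>p \<mapsto> p \<circ> F\<^sub>s\<close> followed by taking the constant coefficient.\<close>

definition dual_functional :: "nat \<Rightarrow> nat \<Rightarrow> (nat \<times> 'n::finite \<Rightarrow> 'k::comm_ring_1) \<Rightarrow> ('n, 'k) mpoly \<Rightarrow> 'k" where
  "dual_functional d s a p = (\<Sum>m\<in>Poly_Mapping.keys p. Poly_Mapping.lookup p m *
     (if mdeg m = d then \<Sum>i\<in>{1..s}. mval m (\<lambda>j. a (i, j)) else 0))"

lemma dual_functional_superset:
  assumes "finite J" "Poly_Mapping.keys p \<subseteq> J"
  shows "dual_functional d s a p = (\<Sum>m\<in>J. Poly_Mapping.lookup p m *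
     (if mdeg m = d then \<Sum>i\<in>{1..s}. mval m (\<lambda>j. a (i, j)) else 0))"
  unfolding dual_functional_def
  by (rule sum.mono_neutral_left) (use assms in \<open>auto simp: in_keys_iff\<close>)

lemma dual_functional_single:
  "dual_functional d s a (Poly_Mapping.single m c) =
     c * (if mdeg m = d then \<Sum>i\<in>{1..s}. mval m (\<lambda>j. a (i, j)) else 0)"
  by (subst dual_functional_superset[of "{m}"]) (auto simp: lookup_single when_def)

lemma dual_functional_add:
  "dual_functional d s a (p + q) = dual_functional d s a p + dual_functional d s a q"
proof -
  let ?J = "Poly_Mapping.keys p \<union> Poly_Mapping.keys q"
  have "dual_functional d s a (p + q) = (\<Sum>m\<in>?J. Poly_Mapping.lookup (p + q) m *
     (if mdeg m = d then \<Sum>i\<in>{1..s}. mval m (\<lambda>j. a (i, j)) else 0))"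
    by (rule dual_functional_superset) (use keys_add[of p q] in auto)
  also have "\<dots> = dual_functional d s a p + dual_functional d s a q"
    by (simp add: lookup_add sum.distrib distrib_right dual_functional_superset[of ?J])
  finally show ?thesis .
qed

lemma dual_functional_scale:
  "dual_functional d s a (mconst c * p) = c * dual_functional d s a p"
  by (induction p rule: poly_mapping_sum_induct)
    (simp_all add: dual_functional_add distrib_left mconst_def mult_single dual_functional_single,
     simp add: dual_functional_def)

lemma dual_functional_sum:
  "dual_functional d s a (sum f A) = (\<Sum>x\<in>A. dual_functional d s a (f x))"
  by (induction A rule: infinite_finite_induct)
    (simp_all add: dual_functional_add, simp_all add: dual_functional_def)

lemma dual_functional_hom:
  assumes "p \<in> hom_part d"
  shows "dual_functional d s a p = (\<Sum>i\<in>{1..s}. mpoly_eval p (\<lambda>j. a (i, j)))"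
proof -
  have "dual_functional d s a p =
      (\<Sum>m\<in>Poly_Mapping.keys p. Poly_Mapping.lookup p m * (\<Sum>i\<in>{1..s}. mval m (\<lambda>j. a (i, j))))"
    unfolding dual_functional_def
    by (rule sum.cong) (use assms in \<open>auto simp: hom_part_iff in_keys_iff\<close>)
  also have "\<dots> = (\<Sum>i\<in>{1..s}. mpoly_eval p (\<lambda>j. a (i, j)))"
    unfolding mpoly_eval_def mval_def[symmetric] sum_distrib_left by (rule sum.swap)
  finally show ?thesis .
qed

lemma dual_functional_other_degree:
  assumes "p \<in> hom_part e" "e \<noteq> d"
  shows "dual_functional d s a p = 0"
  unfolding dual_functional_def
  by (rule sum.neutral) (use assms in \<open>auto simp: hom_part_iff in_keys_iff\<close>)

lemma dp_coeff_scale: "dp_coeff (mconst c * F) k = c * dp_coeff F k"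
  by (simp add: dp_coeff_def mult.left_commute)

lemma dp_coeff_sum: "dp_coeff (sum f A) k = (\<Sum>x\<in>A. dp_coeff (f x) k)"
  by (simp add: dp_coeff_def lookup_sum sum_distrib_left)

text \<open>Both sides pair \<open>p * x ^ k\<close> with \<open>F\<^sub>s\<close>: taking the \<open>k\<close>-th divided power coefficient of \<open>p \<circ> F\<^sub>s\<close>
  amounts to differentiating \<open>k\<close> more times and then taking the constant coefficient.\<close>

lemma dp_coeff_diff_act_power_sum:
  fixes a :: "nat \<times> 'n::finite \<Rightarrow> 'k::field_char_0"
  shows "dp_coeff (diff_act p (power_sum d s a)) k =
    fact d * dual_functional d s a (p * Poly_Mapping.single k 1)"
proof -
  have "dp_coeff (diff_act p (power_sum d s a)) k =
      (\<Sum>m\<in>Poly_Mapping.keys p. Poly_Mapping.lookup p m * dp_coeff (power_sum d s a) (k + m))"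
    by (simp add: diff_act_def dp_coeff_sum dp_coeff_scale dp_coeff_pdiff_monom)
  also have "\<dots> = (\<Sum>m\<in>Poly_Mapping.keys p. fact d * dual_functional d s a
      (Poly_Mapping.single m (Poly_Mapping.lookup p m) * Poly_Mapping.single k 1))"
    by (rule sum.cong[OF refl])
       (simp add: power_sum_def dp_coeff_sum dp_coeff_lin_form_power mult_single
        dual_functional_single add.commute[of k] sum_distrib_left mult_ac)
  also have "\<dots> = fact d * dual_functional d s a
      ((\<Sum>m\<in>Poly_Mapping.keys p. Poly_Mapping.single m (Poly_Mapping.lookup p m)) *
        Poly_Mapping.single k 1)"
    by (simp add: sum_distrib_left sum_distrib_right dual_functional_sum)
  finally show ?thesis
    by (simp flip: keys_sum_single)
qed

text \<open>Macaulay duality: the annihilator is the radical of the pairing defined by the dual functional, since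
  testing against all monomials recovers all coefficients of \<open>p \<circ> F\<^sub>s\<close>.\<close>

lemma ann_power_sum_iff:
  fixes a :: "nat \<times> 'n::finite \<Rightarrow> 'k::field_char_0"
  shows "p \<in> ann (power_sum d s a) \<longleftrightarrow> (\<forall>q. dual_functional d s a (p * q) = 0)"
proof -
  have "diff_act p (power_sum d s a) = 0 \<longleftrightarrow>
      (\<forall>k. dp_coeff (diff_act p (power_sum d s a)) k = 0)"
    by (auto simp: dp_coeff_def mfact_nonzero intro!: poly_mapping_eqI)
  also have "\<dots> \<longleftrightarrow> (\<forall>k. dual_functional d s a (p * Poly_Mapping.single k 1) = 0)"
    by (simp add: dp_coeff_diff_act_power_sum)
  also have "\<dots> \<longleftrightarrow> (\<forall>q. dual_functional d s a (p * q) = 0)"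
  proof safe
    fix q assume *: "\<forall>k. dual_functional d s a (p * Poly_Mapping.single k 1) = 0"
    have "dual_functional d s a (p * Poly_Mapping.single k c) = 0" for k c
    proof -
      have "p * Poly_Mapping.single k c = mconst c * (p * Poly_Mapping.single k 1)"
        by (simp add: mconst_def mult.left_commute mult_single)
      then show ?thesis
        by (simp add: dual_functional_scale *)
    qed
    then show "dual_functional d s a (p * q) = 0"
      by (induction q rule: poly_mapping_sum_induct)
        (simp_all add: distrib_left dual_functional_add, simp add: dual_functional_def)
  qed simp
  finally show ?thesis
    by (simp add: ann_def)
qed

section \<open>Bases of the quotient algebra\<close>

lemma cring_mpoly_ring: "cring (mpoly_ring :: ('n, 'k::comm_ring_1) mpoly ring)"
  by (intro cringI abelian_groupI comm_monoidI)
    (auto simp: mpoly_ring_def algebra_simps intro: exI[of _ "- _"])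

text \<open>What the construction of Jordan bases needs to know about \<open>F\<close>: its annihilator is the radical of a
  pairing that comes from a linear functional concentrated in degree \<open>d\<close>.\<close>

locale macaulay_dual =
  fixes F :: "('n::finite, 'k::field) mpoly" and \<psi> :: "('n, 'k) mpoly \<Rightarrow> 'k" and d :: nat
  assumes psi_add: "\<psi> (p + q) = \<psi> p + \<psi> q"
    and psi_scale: "\<psi> (mconst c * p) = c * \<psi> p"
    and psi_other_degree: "p \<in> hom_part e \<Longrightarrow> e \<noteq> d \<Longrightarrow> \<psi> p = 0"
    and psi_nonzero: "\<exists>p. \<psi> p \<noteq> 0"
    and ann_iff: "p \<in> ann F \<longleftrightarrow> (\<forall>q. \<psi> (p * q) = 0)"
begin

lemma psi_zero [simp]: "\<psi> 0 = 0"
  using psi_scale[of 0 0] by simp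

lemma psi_minus: "\<psi> (- p) = - \<psi> p"
  using psi_scale[of "-1" p] by (simp add: mconst_minus)

lemma psi_diff: "\<psi> (p - q) = \<psi> p - \<psi> q"
  using psi_add[of p "- q"] by (simp add: psi_minus)

lemma psi_sum: "\<psi> (sum f A) = (\<Sum>x\<in>A. \<psi> (f x))"
  by (induction A rule: infinite_finite_induct) (simp_all add: psi_add)

lemma ann_psi: "p \<in> ann F \<Longrightarrow> \<psi> (p * q) = 0"
  by (simp add: ann_iff)

lemma ann_zero: "0 \<in> ann F"
  and ann_add: "p \<in> ann F \<Longrightarrow> q \<in> ann F \<Longrightarrow> p + q \<in> ann F"
  and ann_diff: "p \<in> ann F \<Longrightarrow> q \<in> ann F \<Longrightarrow> p - q \<in> ann F"
  and ann_minus: "p \<in> ann F \<Longrightarrow> - p \<in> ann F"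
  by (simp_all add: ann_iff distrib_right left_diff_distrib psi_add psi_diff psi_minus)

lemma ann_mult: "p \<in> ann F \<Longrightarrow> q * p \<in> ann F"
  by (simp add: ann_iff mult.assoc mult.left_commute[of q])

lemma ann_mult_right: "p \<in> ann F \<Longrightarrow> p * q \<in> ann F"
  using ann_mult[of p q] by (simp add: mult.commute)

lemma one_not_ann: "1 \<notin> ann F"
  using psi_nonzero by (simp add: ann_iff)

lemma ideal_ann: "ideal (ann F) mpoly_ring"
proof (rule idealI)
  interpret R: cring "mpoly_ring :: ('n, 'k) mpoly ring"
    by (rule cring_mpoly_ring)
  show "ring (mpoly_ring :: ('n, 'k) mpoly ring)"
    by (rule R.ring_axioms)
  show "subgroup (ann F) (add_monoid mpoly_ring)"
  proof (rule R.add.subgroupI)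
    fix p assume p: "p \<in> ann F"
    have "\<ominus>\<^bsub>mpoly_ring\<^esub> p = - p"
      by (rule R.minus_equality) (simp_all add: mpoly_ring_def)
    then show "\<ominus>\<^bsub>mpoly_ring\<^esub> p \<in> ann F"
      using ann_minus[OF p] by simp
  qed (use ann_zero ann_add in \<open>auto simp: mpoly_ring_def\<close>)
qed (auto simp: mpoly_ring_def ann_mult ann_mult_right)

lemma ring_hom_cls: "ring_hom_ring mpoly_ring (alg F) (cls F)"
  using ideal.rcos_ring_hom_ring[OF ideal_ann] unfolding alg_def cls_def[abs_def] .

sublocale alg: ring "alg F"
  unfolding alg_def by (rule ideal.quotient_is_ring[OF ideal_ann])

lemma cls_mult: "cls F p \<otimes>\<^bsub>alg F\<^esub> cls F q = cls F (p * q)"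
  using ring_hom_ring.homh[OF ring_hom_cls] ring_hom_mult[of "cls F" mpoly_ring "alg F" p q]
  by (simp add: mpoly_ring_def)

lemma cls_add: "cls F p \<oplus>\<^bsub>alg F\<^esub> cls F q = cls F (p + q)"
  using ring_hom_ring.homh[OF ring_hom_cls] ring_hom_add[of "cls F" mpoly_ring "alg F" p q]
  by (simp add: mpoly_ring_def)

lemma cls_one: "\<one>\<^bsub>alg F\<^esub> = cls F 1"
  using ring_hom_ring.homh[OF ring_hom_cls] ring_hom_one[of "cls F" mpoly_ring "alg F"]
  by (simp add: mpoly_ring_def)

lemma cls_eq_iff: "cls F p = cls F q \<longleftrightarrow> p - q \<in> ann F"
proof -
  have cls: "cls F p = {h + p |h. h \<in> ann F}" for p
    by (auto simp: cls_def a_r_coset_def' mpoly_ring_def)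
  show ?thesis
  proof
    assume "cls F p = cls F q"
    moreover have "p \<in> cls F p"
      using ann_zero by (auto simp: cls)
    ultimately show "p - q \<in> ann F"
      by (auto simp: cls)
  next
    assume pq: "p - q \<in> ann F"
    have "h + p = (h + (p - q)) + q" "h + q = (h - (p - q)) + p" for h
      by simp_all
    then show "cls F p = cls F q"
      using ann_add[OF _ pq] ann_diff[OF _ pq] unfolding cls by blast
  qed
qed

lemma cls_zero: "\<zero>\<^bsub>alg F\<^esub> = cls F 0"
proof -
  have "\<zero>\<^bsub>alg F\<^esub> = ann F"
    by (simp add: alg_def FactRing_def)
  also have "\<dots> = cls F 0"
    by (auto simp: cls_def a_r_coset_def' mpoly_ring_def)
  finally show ?thesis .
qed

lemma carrier_alg: "carrier (alg F) = range (cls F)"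
  by (auto simp: alg_def FactRing_def A_RCOSETS_def' cls_def mpoly_ring_def)

lemma subfield_scalars: "subfield (scalars F) (alg F)"
proof -
  interpret R: cring "mpoly_ring :: ('n, 'k) mpoly ring"
    by (rule cring_mpoly_ring)
  have "subfield (range mconst) (mpoly_ring :: ('n, 'k) mpoly ring)"
  proof (rule R.subfieldI)
    have neg: "\<ominus>\<^bsub>mpoly_ring\<^esub> p = - p" for p :: "('n, 'k) mpoly"
      by (rule R.minus_equality) (simp_all add: mpoly_ring_def)
    show "subcring (range mconst) (mpoly_ring :: ('n, 'k) mpoly ring)"
    proof (rule R.subcringI, rule R.subringI)
      fix p q :: "('n, 'k) mpoly" assume pq: "p \<in> range mconst" "q \<in> range mconst"
      show "\<ominus>\<^bsub>mpoly_ring\<^esub> p \<in> range mconst"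
        using pq unfolding neg by (auto simp flip: mconst_minus)
      show "p \<otimes>\<^bsub>mpoly_ring\<^esub> q \<in> range mconst" "p \<oplus>\<^bsub>mpoly_ring\<^esub> q \<in> range mconst"
        using pq by (auto simp: mpoly_ring_def simp flip: mconst_mult mconst_add)
    qed (auto simp: mpoly_ring_def mult.commute simp flip: mconst_one)
    show "Units (mpoly_ring\<lparr>carrier := range mconst\<rparr>) =
        range mconst - {\<zero>\<^bsub>mpoly_ring\<^esub> :: ('n, 'k) mpoly}"
    proof -
      have "\<exists>q\<in>range mconst. q * mconst c = 1 \<and> mconst c * q = 1"
        if "mconst c \<noteq> (0 :: ('n, 'k) mpoly)" for c :: 'k
      proof -
        have "c \<noteq> 0" using that by auto
        then show ?thesis
          by (intro bexI[of _ "mconst (inverse c)"]) (simp_all flip: mconst_mult)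
      qed
      then show ?thesis
        by (auto simp: Units_def mpoly_ring_def)
    qed
  qed
  moreover have "\<one>\<^bsub>alg F\<^esub> \<noteq> \<zero>\<^bsub>alg F\<^esub>"
    using one_not_ann by (simp add: cls_one cls_zero cls_eq_iff)
  ultimately have "subfield (cls F ` range mconst) (alg F)"
    by (rule ring_hom_ring.img_is_subfield(2)[OF ring_hom_cls])
  then show ?thesis
    by (simp add: scalars_def image_image)
qed

lemma combine_cls:
  "alg.combine (map (\<lambda>t. cls F (mconst (c t))) ts) (map (\<lambda>t. cls F (b t)) ts) =
     cls F (\<Sum>t\<leftarrow>ts. mconst (c t) * b t)"
  by (induction ts) (simp_all add: cls_zero cls_mult cls_add)

text \<open>Coefficient lists are turned into functions on the index list of a basis, so that linear combinations
  can be handled as sums over finite sets of indices.\<close>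

lemma scalar_list_as_function:
  assumes "distinct ts" "length Ks = length ts" "set Ks \<subseteq> scalars F"
  obtains c where "Ks = map (\<lambda>t. cls F (mconst (c t))) ts"
proof -
  have "\<exists>c. Ks = map (\<lambda>t. cls F (mconst (c t))) ts"
    using assms(2,1,3)
  proof (induction Ks ts rule: list_induct2)
    case (Cons k Ks t ts)
    then obtain c x where c: "Ks = map (\<lambda>t. cls F (mconst (c t))) ts" and x: "k = cls F (mconst x)"
      by (auto simp: scalars_def)
    have "k # Ks = map (\<lambda>u. cls F (mconst ((c(t := x)) u))) (t # ts)"
      using Cons.prems by (auto simp: c x)
    then show ?case by (rule exI[of _ "c(t := x)"])
  qed simp
  then show ?thesis using that by blast
qed

text \<open>Translates the basis predicate of the quotient algebra into statements about representing polynomials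
  modulo the annihilator; all later bases are obtained through it.\<close>

lemma is_basisI:
  assumes ts: "distinct ts"
    and closed: "\<And>c. (\<Sum>t\<in>set ts. mconst (c t) * b t) \<in> V"
    and indep: "\<And>c t. (\<Sum>t\<in>set ts. mconst (c t) * b t) \<in> ann F \<Longrightarrow> t \<in> set ts \<Longrightarrow> c t = 0"
    and span: "\<And>w. w \<in> V \<Longrightarrow> \<exists>c. w - (\<Sum>t\<in>set ts. mconst (c t) * b t) \<in> ann F"
  shows "is_basis F (map (\<lambda>t. cls F (b t)) ts) (cls F ` V)"
  unfolding is_basis_def
proof
  let ?Us = "map (\<lambda>t. cls F (b t)) ts"
  have Us: "set ?Us \<subseteq> carrier (alg F)"
    by (auto simp: carrier_alg)
  have combine: "alg.combine (map (\<lambda>t. cls F (mconst (c t))) ts) ?Us =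
      cls F (\<Sum>t\<in>set ts. mconst (c t) * b t)" for c
    by (simp add: combine_cls sum_list_distinct_conv_sum_set[OF ts])
  have Ks: "set (map (\<lambda>t. cls F (mconst (c t))) ts) \<subseteq> scalars F" for c
    by (auto simp: scalars_def)
  show "alg.independent (scalars F) ?Us"
  proof (rule alg.trivial_combine_imp_independent[OF subfield_scalars Us])
    fix Ks assume *: "set Ks \<subseteq> scalars F" "alg.combine Ks ?Us = \<zero>\<^bsub>alg F\<^esub>"
    show "set (take (length ?Us) Ks) \<subseteq> {\<zero>\<^bsub>alg F\<^esub>}"
    proof (cases "length ts \<le> length Ks")
      case True
      obtain c where c: "take (length ts) Ks = map (\<lambda>t. cls F (mconst (c t))) ts"
        by (rule scalar_list_as_function[OF ts, of "take (length ts) Ks"])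
           (use True * in \<open>auto dest: in_set_takeD\<close>)
      have "alg.combine Ks ?Us = cls F (\<Sum>t\<in>set ts. mconst (c t) * b t)"
        using alg.combine_take[of ?Us Ks] c combine[of c] by simp
      then have "(\<Sum>t\<in>set ts. mconst (c t) * b t) \<in> ann F"
        using *(2) unfolding cls_zero by (metis cls_eq_iff diff_zero)
      then have "c t = 0" if "t \<in> set ts" for t
        using indep that by blast
      then show ?thesis
        by (simp add: c cls_zero image_subset_iff)
    next
      case False
      obtain c where c: "Ks @ replicate (length ts - length Ks) \<zero>\<^bsub>alg F\<^esub> = map (\<lambda>t. cls F (mconst (c t))) ts"
        by (rule scalar_list_as_function[OF ts, of "Ks @ replicate (length ts - length Ks) \<zero>\<^bsub>alg F\<^esub>"])
           (use False * in \<open>auto simp: scalars_def cls_zero image_iff simp flip: mconst_zero\<close>)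
      have "alg.combine Ks ?Us = cls F (\<Sum>t\<in>set ts. mconst (c t) * b t)"
        unfolding combine[symmetric] c[symmetric]
        using alg.combine_append_replicate[OF Us] by simp
      then have "(\<Sum>t\<in>set ts. mconst (c t) * b t) \<in> ann F"
        using *(2) unfolding cls_zero by (metis cls_eq_iff diff_zero)
      then have "c t = 0" if "t \<in> set ts" for t
        using indep that by blast
      then have "set (map (\<lambda>t. cls F (mconst (c t))) ts) \<subseteq> {\<zero>\<^bsub>alg F\<^esub>}"
        by (simp add: cls_zero image_subset_iff)
      then show ?thesis
        unfolding c[symmetric] using set_take_subset by fastforce
    qed
  qed
  show "alg.Span (scalars F) ?Us = cls F ` V"
  proof
    show "alg.Span (scalars F) ?Us \<subseteq> cls F ` V"
    proof
      fix x assume "x \<in> alg.Span (scalars F) ?Us"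
      then obtain Ks where Ks: "length Ks = length ?Us" "set Ks \<subseteq> scalars F" "x = alg.combine Ks ?Us"
        unfolding alg.Span_eq_combine_set_length_version[OF subfield_scalars Us] by blast
      obtain c where "Ks = map (\<lambda>t. cls F (mconst (c t))) ts"
        by (rule scalar_list_as_function[OF ts, of Ks]) (use Ks in auto)
      then have "x = cls F (\<Sum>t\<in>set ts. mconst (c t) * b t)"
        unfolding Ks(3) combine[symmetric] by (rule arg_cong)
      then show "x \<in> cls F ` V"
        using closed[of c] by (rule image_eqI)
    qed
    show "cls F ` V \<subseteq> alg.Span (scalars F) ?Us"
    proof
      fix x assume "x \<in> cls F ` V"
      then obtain w where "w \<in> V" "x = cls F w" by blast
      then obtain c where "x = cls F (\<Sum>t\<in>set ts. mconst (c t) * b t)"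
        using span[of w] by (auto simp: cls_eq_iff)
      then show "x \<in> alg.Span (scalars F) ?Us"
        unfolding alg.Span_eq_combine_set[OF subfield_scalars Us] combine[symmetric]
        using Ks by blast
    qed
  qed
qed

lemma h_vec_eq_length: "is_basis F Us (graded_part F i) \<Longrightarrow> h_vec F i = length Us"
  using alg.dimI[OF subfield_scalars alg.dimensionI[OF subfield_scalars]]
  by (simp add: is_basis_def h_vec_def over_def)

lemma lincomb_cls:
  "lincomb F c (map (\<lambda>t. cls F (b t)) ts) =
     cls F (\<Sum>i<length ts. mconst (c i) * b (ts ! i))"
proof -
  have "map (\<lambda>t. cls F (b t)) ts = map (\<lambda>i. cls F (b (ts ! i))) [0..<length ts]"
    by (rule nth_equalityI) auto
  then have "lincomb F c (map (\<lambda>t. cls F (b t)) ts) =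
      cls F (\<Sum>i\<leftarrow>[0..<length ts]. mconst (c i) * b (ts ! i))"
    by (simp add: lincomb_def combine_cls)
  then show ?thesis
    by (simp add: interv_sum_list_conv_sum_set_nat atLeast0LessThan)
qed

end

section \<open>Pairings and Jordan strings\<close>

context macaulay_dual
begin

text \<open>Pairing a relation with \<open>u t\<close> isolates the coefficient of \<open>b t\<close>.\<close>

lemma independent_of_dual_family:
  assumes "finite T"
    and dual: "\<And>s t. s \<in> T \<Longrightarrow> t \<in> T \<Longrightarrow> \<psi> (b s * u t) \<noteq> 0 \<longleftrightarrow> s = t"
    and sum: "(\<Sum>t\<in>T. mconst (c t) * b t) \<in> ann F" and t: "t \<in> T"
  shows "c t = 0"
proof -
  have "0 = \<psi> ((\<Sum>s\<in>T. mconst (c s) * b s) * u t)"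
    using ann_psi[OF sum] by simp
  also have "\<dots> = (\<Sum>s\<in>T. c s * \<psi> (b s * u t))"
    by (simp add: sum_distrib_right psi_sum psi_scale mult.assoc)
  also have "\<dots> = (\<Sum>s\<in>T. if s = t then c t * \<psi> (b t * u t) else 0)"
    by (rule sum.cong) (use dual t in auto)
  also have "\<dots> = c t * \<psi> (b t * u t)"
    using assms(1) t by simp
  finally show ?thesis
    using dual[OF t t] by simp
qed

text \<open>A form of degree \<open>f\<close> pairs only with the degree \<open>d - f\<close> parts of polynomials, so testing against these
  suffices.\<close>

lemma ann_homI:
  assumes w: "w \<in> hom_part f"
    and pair: "\<And>q. f \<le> d \<Longrightarrow> q \<in> hom_part (d - f) \<Longrightarrow> \<psi> (w * q) = 0"
  shows "w \<in> ann F"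
  unfolding ann_iff
proof
  fix q
  have "\<psi> (w * Poly_Mapping.single m c) = 0" for m c
  proof (cases "f + mdeg m = d")
    case True
    then show ?thesis
      using pair[of "Poly_Mapping.single m c"] hom_part_single[of m "d - f" c] by auto
  next
    case False
    then show ?thesis
      using psi_other_degree hom_part_mult[OF w hom_part_single[OF refl]] by blast
  qed
  then show "\<psi> (w * q) = 0"
    by (induction q rule: poly_mapping_sum_induct) (simp_all add: distrib_left psi_add)
qed

lemma psi_congruent:
  assumes "p - q \<in> ann F"
  shows "\<psi> (w * p) = \<psi> (w * q)"
  using ann_psi[OF assms, of w] by (simp add: mult.commute[of w] left_diff_distrib psi_diff)

lemma psi_span_zero:
  assumes "q - (\<Sum>t\<in>T. mconst (c t) * b t) \<in> ann F" "\<And>t. t \<in> T \<Longrightarrow> \<psi> (w * b t) = 0"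
  shows "\<psi> (w * q) = 0"
proof -
  have "\<psi> (w * q) = \<psi> (w * (\<Sum>t\<in>T. mconst (c t) * b t))"
    by (rule psi_congruent[OF assms(1)])
  also have "\<dots> = (\<Sum>t\<in>T. c t * \<psi> (w * b t))"
    by (simp add: sum_distrib_left psi_sum psi_scale mult.left_commute[of w "mconst _"])
  finally show ?thesis
    using assms(2) by simp
qed

text \<open>The basis vectors of a string are listed with the highest power of \<open>l\<close> first, because a Jordan block
  has its ones above the diagonal and so maps each basis vector to its predecessor.\<close>

definition string_indices :: "('s \<Rightarrow> nat) \<Rightarrow> 's list \<Rightarrow> ('s \<times> nat) list" where
  "string_indices len ss = concat (map (\<lambda>s. map (\<lambda>k. (s, k)) (rev [0..<len s])) ss)"

lemma sum_lessThan_add: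
  "(\<Sum>i<m + n. f i) = (\<Sum>i<m. f i) + (\<Sum>i<n. f (m + i :: nat))" for f :: "nat \<Rightarrow> 'z::comm_monoid_add"
  by (induction n) (simp_all add: add.assoc)

text \<open>Multiplication by \<open>l\<close> climbs along each string and annihilates its top, which is the action described
  column by column by the nilpotent Jordan matrix.\<close>

lemma jordan_strings:
  assumes "\<And>s k. s \<in> set ss \<Longrightarrow> Suc k < len s \<Longrightarrow> l * g (s, k) = g (s, Suc k)"
    and "\<And>s. s \<in> set ss \<Longrightarrow> len s > 0 \<Longrightarrow> l * g (s, len s - 1) \<in> ann F"
    and "j < length (string_indices len ss)"
  shows "l * g (string_indices len ss ! j) -
    (\<Sum>i<length (string_indices len ss).
      mconst (jordan_matrix (map (\<lambda>s. (len s, 0)) ss) $$ (i, j)) * g (string_indices len ss ! i))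
    \<in> ann F"
  using assms
proof (induction ss arbitrary: j)
  case Nil
  then show ?case by (simp add: string_indices_def)
next
  case (Cons s ss)
  let ?T = "string_indices len ss" and ?n = "len s"
  let ?M = "jordan_matrix (map (\<lambda>s. (len s, 0 :: 'k)) ss)"
  have T: "string_indices len (s # ss) = map (\<lambda>k. (s, k)) (rev [0..<?n]) @ ?T"
    by (simp add: string_indices_def)
  have lenT: "length ?T = sum_list (map len ss)"
    by (simp add: string_indices_def length_concat comp_def)
  have nth_fst: "string_indices len (s # ss) ! i = (s, ?n - 1 - i)" if "i < ?n" for i
    using that by (simp add: T nth_append rev_nth)
  have nth_snd: "string_indices len (s # ss) ! (?n + i) = ?T ! i" for i
    by (simp add: T nth_append)
  have M: "jordan_matrix (map (\<lambda>s. (len s, 0 :: 'k)) (s # ss)) $$ (i, j) =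
      (if i < ?n then if j < ?n then if Suc i = j then 1 else 0 else 0
       else if j < ?n then 0 else ?M $$ (i - ?n, j - ?n))"
    if "i < ?n + length ?T" "j < ?n + length ?T" for i j
    using that by (auto simp: jordan_matrix_Cons lenT comp_def)
  have j: "j < ?n + length ?T"
    using Cons.prems(3) by (simp add: T)
  have sum: "(\<Sum>i<length (string_indices len (s # ss)).
      mconst (jordan_matrix (map (\<lambda>s. (len s, 0)) (s # ss)) $$ (i, j)) *
        g (string_indices len (s # ss) ! i)) =
      (\<Sum>i<?n. mconst (if j < ?n \<and> Suc i = j then 1 else 0) * g (s, ?n - 1 - i)) +
      (\<Sum>i<length ?T. mconst (if j < ?n then 0 else ?M $$ (i, j - ?n)) * g (?T ! i))"
  proof -
    have length: "length (string_indices len (s # ss)) = ?n + length ?T"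
      by (simp add: T)
    show ?thesis
      unfolding length sum_lessThan_add
      by (intro arg_cong2[of _ _ _ _ "(+)"] sum.cong)
         (use j in \<open>auto simp: M nth_fst nth_snd simp del: list.map\<close>)
  qed
  show ?case
  proof (cases "j < ?n")
    case True
    have "(\<Sum>i<?n. mconst (if j < ?n \<and> Suc i = j then 1 else 0) * g (s, ?n - 1 - i)) =
        (\<Sum>i<?n. if Suc i = j then g (s, ?n - 1 - i) else 0)"
      using True by (intro sum.cong) auto
    also have "\<dots> = (if j = 0 then 0 else g (s, ?n - j))"
    proof (cases j)
      case (Suc j')
      then show ?thesis using True by simp
    qed simp
    finally have *: "(\<Sum>i<length (string_indices len (s # ss)).
      mconst (jordan_matrix (map (\<lambda>s. (len s, 0)) (s # ss)) $$ (i, j)) *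
        g (string_indices len (s # ss) ! i)) = (if j = 0 then 0 else g (s, ?n - j))"
      unfolding sum using True by simp
    show ?thesis
    proof (cases "j = 0")
      case j0: True
      then show ?thesis
        unfolding * nth_fst[OF True] using Cons.prems(2)[of s] True by simp
    next
      case False
      have "l * g (s, ?n - 1 - j) = g (s, ?n - j)"
        using Cons.prems(1)[of s "?n - 1 - j"] True False by (simp add: Suc_diff_Suc)
      then show ?thesis
        unfolding * nth_fst[OF True] using False ann_zero by simp
    qed
  next
    case False
    define j' where "j' = j - ?n"
    have j': "j = ?n + j'" "j' < length ?T"
      using False j by (auto simp: j'_def)
    have "l * g (?T ! j') - (\<Sum>i<length ?T. mconst (?M $$ (i, j')) * g (?T ! i)) \<in> ann F"
      by (rule Cons.IH) (use Cons.prems(1,2) j' in auto)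
    then show ?thesis
      unfolding sum by (simp add: j'(1) nth_snd)
  qed
qed

lemma has_jordan_type_strings:
  assumes basis: "is_basis F (map (\<lambda>t. cls F (g t)) (string_indices len ss)) (carrier (alg F))"
    and step: "\<And>s k. s \<in> set ss \<Longrightarrow> Suc k < len s \<Longrightarrow> l * g (s, k) = g (s, Suc k)"
    and last: "\<And>s. s \<in> set ss \<Longrightarrow> l * g (s, len s - 1) \<in> ann F"
    and pos: "\<And>s. s \<in> set ss \<Longrightarrow> len s > 0"
  shows "has_jordan_type F (cls F l) (mset (map len ss))"
proof -
  let ?T = "string_indices len ss"
  let ?Us = "map (\<lambda>t. cls F (g t)) ?T"
  let ?M = "jordan_matrix (map (\<lambda>p. (p, 0 :: 'k)) (map len ss))"
  have len: "length ?T = sum_list (map len ss)"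
    by (simp add: string_indices_def length_concat comp_def)
  have M: "?M \<in> carrier_mat (length ?Us) (length ?Us)"
    unfolding length_map len by (rule carrier_matI) (simp_all only: jordan_matrix_dim map_map comp_def fst_conv)
  have maps: "map (\<lambda>p. (p, 0 :: 'k)) (map len ss) = map (\<lambda>s. (len s, 0)) ss"
    by simp
  show ?thesis
    unfolding has_jordan_type_def
  proof (rule exI[of _ ?Us], rule exI[of _ ?M], rule exI[of _ "map len ss"], intro conjI allI impI)
    show "is_basis F ?Us (carrier (alg F))"
      by (rule basis)
    show "jordan_nf ?M (map (\<lambda>p. (p, 0)) (map len ss))"
      unfolding jordan_nf_def using similar_mat_refl[OF M] by (auto dest: pos)
    show "?M \<in> carrier_mat (length ?Us) (length ?Us)"
      by (rule M)
    fix j assume j: "j < length ?Us"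
    have "l * g (?T ! j) - (\<Sum>i<length ?T. mconst (?M $$ (i, j)) * g (?T ! i)) \<in> ann F"
      unfolding maps by (rule jordan_strings) (use step last j in auto)
    then show "cls F l \<otimes>\<^bsub>alg F\<^esub> ?Us ! j = lincomb F (\<lambda>i. ?M $$ (i, j)) ?Us"
      using j by (simp add: lincomb_cls cls_mult cls_eq_iff)
  qed (rule refl)
qed

end

section \<open>Jordan bases from strong Lefschetz elements\<close>

text \<open>The strong Lefschetz property in narrow form: for \<open>e \<le> d div 2\<close>, the form \<open>B\<^sub>e\<close> induced by \<open>l\<close> on the degree
  \<open>e\<close> part of the algebra is nondegenerate.\<close>

locale lefschetz = macaulay_dual F \<psi> d
  for F :: "('n::finite, 'k::field_char_0) mpoly" and \<psi> d +
  fixes l :: "('n, 'k) mpoly"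
  assumes l: "l \<in> hom_part 1"
    and nondegenerate: "\<And>e w. e \<le> d div 2 \<Longrightarrow> w \<in> hom_part e \<Longrightarrow>
      (\<And>q. q \<in> hom_part e \<Longrightarrow> \<psi> (l ^ (d - 2 * e) * (w * q)) = 0) \<Longrightarrow> w \<in> ann F"
    and graded_basis: "\<And>e. e \<le> d div 2 \<Longrightarrow> \<exists>Us. is_basis F Us (graded_part F e)"
begin

definition primitive :: "nat \<Rightarrow> ('n, 'k) mpoly set" where
  "primitive e = {w \<in> hom_part e. l ^ (d + 1 - 2 * e) * w \<in> ann F}"

definition lform :: "nat \<Rightarrow> ('n, 'k) mpoly \<Rightarrow> ('n, 'k) mpoly \<Rightarrow> 'k" where
  "lform e x y = \<psi> (l ^ (d - 2 * e) * (x * y))"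

definition orthogonal_family :: "nat \<Rightarrow> nat \<Rightarrow> (nat \<Rightarrow> ('n, 'k) mpoly) \<Rightarrow> bool" where
  "orthogonal_family e n v \<longleftrightarrow> (\<forall>j<n. v j \<in> primitive e) \<and>
     (\<forall>i<n. \<forall>j<n. lform e (v i) (v j) \<noteq> 0 \<longleftrightarrow> i = j)"

lemma hom_part_l_power: "w \<in> hom_part e \<Longrightarrow> l ^ k * w \<in> hom_part (k + e)"
  using hom_part_mult[OF hom_part_power[OF l, of k]] by simp

lemma primitive_add: "x \<in> primitive e \<Longrightarrow> y \<in> primitive e \<Longrightarrow> x + y \<in> primitive e"
  and primitive_diff: "x \<in> primitive e \<Longrightarrow> y \<in> primitive e \<Longrightarrow> x - y \<in> primitive e"
  by (simp_all add: primitive_def hom_part_add hom_part_diff distrib_left right_diff_distrib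
      ann_add ann_diff)

lemma primitive_scale: "x \<in> primitive e \<Longrightarrow> mconst c * x \<in> primitive e"
  by (simp add: primitive_def hom_part_scale mult.left_commute[of _ "mconst c"] ann_mult)

lemma primitive_sum: "(\<And>t. t \<in> T \<Longrightarrow> f t \<in> primitive e) \<Longrightarrow> sum f T \<in> primitive e"
  by (induction T rule: infinite_finite_induct)
    (simp_all add: primitive_add, simp_all add: primitive_def ann_zero)

lemma lform_commute: "lform e x y = lform e y x"
  by (simp add: lform_def mult.commute)

lemma lform_add: "lform e (x + y) z = lform e x z + lform e y z"
  and lform_diff: "lform e (x - y) z = lform e x z - lform e y z"
  and lform_scale: "lform e (mconst c * x) z = c * lform e x z"
  by (simp_all add: lform_def distrib_left distrib_right psi_add psi_diff left_diff_distrib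
      right_diff_distrib mult.assoc mult.left_commute[of _ "mconst c"] psi_scale)

lemma lform_sum: "lform e (sum f T) z = (\<Sum>t\<in>T. lform e (f t) z)"
  by (simp add: lform_def sum_distrib_left sum_distrib_right psi_sum)

text \<open>An orthogonal family of anisotropic vectors is its own dual family up to scalars, hence independent.
  The bound makes maximal families available.\<close>

lemma orthogonal_family_bound:
  assumes "e \<le> d div 2" "orthogonal_family e n v"
  shows "n \<le> h_vec F e"
proof -
  obtain Us where Us: "is_basis F Us (graded_part F e)"
    using graded_basis[OF assms(1)] by blast
  have "is_basis F (map (\<lambda>j. cls F (v j)) [0..<n])
      (cls F ` range (\<lambda>c. \<Sum>j\<in>set [0..<n]. mconst (c j) * v j))"
  proof (rule is_basisI)
    fix c j assume "(\<Sum>j\<in>set [0..<n]. mconst (c j) * v j) \<in> ann F" "j \<in> set [0..<n]"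
    then show "c j = 0"
      by (rule independent_of_dual_family[of "set [0..<n]" v "\<lambda>j. l ^ (d - 2 * e) * v j", rotated 2])
         (use assms(2) in \<open>auto simp: orthogonal_family_def lform_def mult.left_commute\<close>)
  next
    show "\<exists>c. w - (\<Sum>j\<in>set [0..<n]. mconst (c j) * v j) \<in> ann F"
      if "w \<in> range (\<lambda>c. \<Sum>j\<in>set [0..<n]. mconst (c j) * v j)" for w
    proof -
      obtain c where "w = (\<Sum>j\<in>set [0..<n]. mconst (c j) * v j)"
        using \<open>w \<in> range _\<close> by blast
      then show ?thesis
        by (intro exI[of _ c]) (simp add: ann_zero)
    qed
  qed auto
  then have "alg.independent (scalars F) (map (\<lambda>j. cls F (v j)) [0..<n])"
    by (simp add: is_basis_def)
  moreover have "alg.dimension (length Us) (scalars F) (graded_part F e)"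
    using Us alg.dimensionI[OF subfield_scalars] by (simp add: is_basis_def)
  moreover have "set (map (\<lambda>j. cls F (v j)) [0..<n]) \<subseteq> graded_part F e"
    using assms(2) by (auto simp: graded_part_def orthogonal_family_def primitive_def)
  ultimately have "length (map (\<lambda>j. cls F (v j)) [0..<n]) \<le> length Us"
    using alg.independent_length_le_dimension[OF subfield_scalars] by blast
  then show ?thesis
    by (simp add: h_vec_eq_length[OF Us])
qed

text \<open>If \<open>x\<close> paired nontrivially with \<open>p\<close>, then \<open>p\<close> could be corrected to some \<open>q\<close> orthogonal to the family
  with the same pairing, and by polarization one of \<open>x\<close>, \<open>q\<close>, \<open>x + q\<close> would be anisotropic and extend the
  family. Here characteristic different from two is essential.\<close>

lemma orthogonal_complement_isotropic:
  assumes orth: "orthogonal_family e n v" and max: "\<And>v'. \<not> orthogonal_family e (Suc n) v'"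
    and x: "x \<in> primitive e" "\<And>j. j < n \<Longrightarrow> lform e x (v j) = 0" and p: "p \<in> primitive e"
  shows "lform e x p = 0"
proof (rule ccontr)
  assume xp: "lform e x p \<noteq> 0"
  have vv: "lform e (v i) (v j) \<noteq> 0 \<longleftrightarrow> i = j" if "i < n" "j < n" for i j
    using orth that by (simp add: orthogonal_family_def)
  have v: "v j \<in> primitive e" if "j < n" for j
    using orth that by (simp add: orthogonal_family_def)
  \<comment> \<open>Gram-Schmidt correction of \<open>p\<close>\<close>
  define q where "q = p - (\<Sum>i<n. mconst (lform e p (v i) / lform e (v i) (v i)) * v i)"
  have q: "q \<in> primitive e"
    unfolding q_def by (intro primitive_diff p primitive_sum primitive_scale v) simp
  have qv: "lform e q (v j) = 0" if j: "j < n" for j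
  proof -
    have "(\<Sum>i<n. lform e p (v i) / lform e (v i) (v i) * lform e (v i) (v j)) =
        (\<Sum>i<n. if i = j then lform e p (v j) else 0)"
      by (rule sum.cong) (use vv j in auto)
    then show ?thesis
      using j by (simp add: q_def lform_diff lform_sum lform_scale)
  qed
  have qx: "lform e q x = lform e x p"
    by (simp add: q_def lform_diff lform_sum lform_scale lform_commute[of e _ x] x(2))
  have "lform e (x + q) (x + q) = lform e x x + lform e q q + 2 * lform e x p"
    by (simp add: lform_add lform_commute[of e _ "x + q"] lform_commute[of e x q] qx)
  then have "lform e x x \<noteq> 0 \<or> lform e q q \<noteq> 0 \<or> lform e (x + q) (x + q) \<noteq> 0"
    using xp by auto
  moreover have "lform e (x + q) (v j) = 0" if "j < n" for j
    using x(2)[OF that] qv[OF that] by (simp add: lform_add)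
  ultimately obtain y where y: "y \<in> primitive e" "\<And>j. j < n \<Longrightarrow> lform e y (v j) = 0" "lform e y y \<noteq> 0"
    using x q qv primitive_add[OF x(1) q] by blast
  have "orthogonal_family e (Suc n) (v(n := y))"
    unfolding orthogonal_family_def
  proof (intro conjI allI impI)
    fix i j assume ij: "i < Suc n" "j < Suc n"
    have vy: "lform e (v j) y = 0" if "j < n" for j
      using y(2)[OF that] by (simp add: lform_commute)
    show "lform e ((v(n := y)) i) ((v(n := y)) j) \<noteq> 0 \<longleftrightarrow> i = j"
      using ij vv[of i j] y(2)[of j] y(3) vy[of i] by (cases "i = n"; cases "j = n") auto
  qed (use y(1) v in \<open>auto simp: less_Suc_eq\<close>)
  then show False
    using max by blast
qed

lemma primitive_bases_exist:
  "\<exists>n v. \<forall>e\<le>d div 2. orthogonal_family e (n e) (v e) \<and>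
     (\<forall>x\<in>primitive e. (\<forall>j<n e. lform e x (v e j) = 0) \<longrightarrow> (\<forall>p\<in>primitive e. lform e x p = 0))"
proof -
  have "\<exists>n v. e \<le> d div 2 \<longrightarrow> orthogonal_family e n v \<and>
     (\<forall>x\<in>primitive e. (\<forall>j<n. lform e x (v j) = 0) \<longrightarrow> (\<forall>p\<in>primitive e. lform e x p = 0))" for e
  proof (cases "e \<le> d div 2")
    case True
    have "\<exists>v. orthogonal_family e 0 v"
      by (simp add: orthogonal_family_def)
    moreover have "\<forall>n. (\<exists>v. orthogonal_family e n v) \<longrightarrow> n \<le> h_vec F e"
      using orthogonal_family_bound[OF True] by blast
    ultimately obtain n where n: "\<exists>v. orthogonal_family e n v"
      "\<And>m. (\<exists>v. orthogonal_family e m v) \<Longrightarrow> m \<le> n"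
      using Nat.ex_has_greatest_nat[of "\<lambda>n. \<exists>v. orthogonal_family e n v" 0 "h_vec F e"] by blast
    then obtain v where v: "orthogonal_family e n v" by blast
    have "\<not> orthogonal_family e (Suc n) v'" for v'
      using n(2)[of "Suc n"] by auto
    then show ?thesis
      using v orthogonal_complement_isotropic[OF v] by blast
  qed simp
  then show ?thesis by metis
qed

end

text \<open>Orthogonal bases \<open>v e\<close> of the primitive parts, of lengths \<open>n e\<close>. Maximality stands in for spanning: what
  is primitive and orthogonal to \<open>v e\<close> lies in the radical of the form on the primitive part.\<close>

locale primitive_bases = lefschetz F \<psi> d l
  for F :: "('n::finite, 'k::field_char_0) mpoly" and \<psi> d l +
  fixes n :: "nat \<Rightarrow> nat" and v :: "nat \<Rightarrow> nat \<Rightarrow> ('n, 'k) mpoly"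
  assumes orthogonal: "\<And>e. e \<le> d div 2 \<Longrightarrow> orthogonal_family e (n e) (v e)"
    and maximal: "\<And>e x p. e \<le> d div 2 \<Longrightarrow> x \<in> primitive e \<Longrightarrow>
      (\<And>j. j < n e \<Longrightarrow> lform e x (v e j) = 0) \<Longrightarrow> p \<in> primitive e \<Longrightarrow> lform e x p = 0"
begin

definition string_elt :: "(nat \<times> nat) \<times> nat \<Rightarrow> ('n, 'k) mpoly" where
  "string_elt t = (case t of ((i, j), k) \<Rightarrow> l ^ k * v i j)"

text \<open>Pairs \<open>(i, j)\<close> index the strings by degree and position of their first vector; these are the strings
  that start in degree at most \<open>e\<close>.\<close>

definition starts :: "nat \<Rightarrow> (nat \<times> nat) set" where
  "starts e = (SIGMA i:{..e}. {..<n i})"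

lemma finite_starts [simp]: "finite (starts e)"
  by (simp add: starts_def)

lemma v_primitive: "i \<le> d div 2 \<Longrightarrow> j < n i \<Longrightarrow> v i j \<in> primitive i"
  using orthogonal by (simp add: orthogonal_family_def)

lemma v_hom: "i \<le> d div 2 \<Longrightarrow> j < n i \<Longrightarrow> v i j \<in> hom_part i"
  using v_primitive by (simp add: primitive_def)

lemma string_elt_hom:
  "i \<le> d div 2 \<Longrightarrow> j < n i \<Longrightarrow> string_elt ((i, j), k) \<in> hom_part (k + i)"
  by (simp add: string_elt_def hom_part_l_power v_hom)

lemma l_power_v_ann:
  assumes "i \<le> d div 2" "j < n i" "k > d - 2 * i"
  shows "l ^ k * v i j \<in> ann F"
proof -
  have "l ^ k = l ^ (k - (d + 1 - 2 * i)) * l ^ (d + 1 - 2 * i)"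
    using assms by (simp flip: power_add)
  then show ?thesis
    using v_primitive[OF assms(1,2)] by (simp add: primitive_def mult.assoc ann_mult)
qed

text \<open>Two vectors whose degrees do not add up to \<open>d\<close> pair to zero. If the degrees add up and the strings
  start in different degrees, the total power of \<open>l\<close> exceeds the length of the later string and kills
  its first vector. If they start in the same degree, the pairing is that of the two first vectors
  under the form of this degree.\<close>

lemma string_pairing:
  assumes i: "i \<le> d div 2" "j < n i" and i': "i' \<le> d div 2" "j' < n i'"
  shows "\<psi> (string_elt ((i, j), k) * string_elt ((i', j'), k')) \<noteq> 0 \<longleftrightarrow>
    i = i' \<and> j = j' \<and> k + k' = d - 2 * i"
proof -
  have prod: "string_elt ((i, j), k) * string_elt ((i', j'), k') = l ^ (k + k') * v i j * v i' j'"
    by (simp add: string_elt_def power_add algebra_simps)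
  have hom: "string_elt ((i, j), k) * string_elt ((i', j'), k') \<in> hom_part (k + i + (k' + i'))"
    by (rule hom_part_mult[OF string_elt_hom[OF i] string_elt_hom[OF i']])
  show ?thesis
  proof (cases "k + i + (k' + i') = d")
    case False
    then show ?thesis
      using psi_other_degree[OF hom False] i by auto
  next
    case deg: True
    consider "i < i'" | "i' < i" | "i = i'" by linarith
    then show ?thesis
    proof cases
      case 1
      then have "k + k' > d - 2 * i'"
        using deg i' by linarith
      from ann_psi[OF l_power_v_ann[OF i' this], of "v i j"] show ?thesis
        using 1 by (simp add: prod mult_ac)
    next
      case 2
      then have "k + k' > d - 2 * i"
        using deg i by linarith
      from ann_psi[OF l_power_v_ann[OF i this], of "v i' j'"] show ?thesis
        using 2 by (simp add: prod mult_ac)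
    next
      case 3
      then have "k + k' = d - 2 * i"
        using deg by linarith
      moreover from this have "\<psi> (string_elt ((i, j), k) * string_elt ((i', j'), k')) =
          lform i (v i j) (v i j')"
        unfolding prod by (simp add: lform_def mult.assoc 3)
      ultimately show ?thesis
        using orthogonal[OF i(1)] i(2) i'(2) 3 by (simp add: orthogonal_family_def)
    qed
  qed
qed

lemma starts_bound: "(i, j) \<in> starts e \<Longrightarrow> e \<le> d div 2 \<Longrightarrow> i \<le> d div 2 \<and> i \<le> e \<and> j < n i"
  by (auto simp: starts_def)

text \<open>The vector of the string \<open>s\<close> in degree \<open>f\<close> has as its partner the vector of the same string in degree
  \<open>d - f\<close>; dividing the pairing with the partner by the norm gives the coordinate of \<open>w\<close>.\<close>

definition string_coeff :: "nat \<Rightarrow> ('n, 'k) mpoly \<Rightarrow> nat \<times> nat \<Rightarrow> 'k" where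
  "string_coeff f w s = \<psi> (w * string_elt (s, d - f - fst s)) /
     \<psi> (string_elt (s, f - fst s) * string_elt (s, d - f - fst s))"

definition string_proj :: "nat \<Rightarrow> (nat \<times> nat) set \<Rightarrow> ('n, 'k) mpoly \<Rightarrow> ('n, 'k) mpoly" where
  "string_proj f S w = (\<Sum>s\<in>S. mconst (string_coeff f w s) * string_elt (s, f - fst s))"

lemma string_proj_hom:
  assumes "S \<subseteq> starts (min f (d - f))" "f \<le> d"
  shows "string_proj f S w \<in> hom_part f"
  unfolding string_proj_def
proof (intro hom_part_sum hom_part_scale)
  fix s assume "s \<in> S"
  then have s: "(fst s, snd s) \<in> starts (min f (d - f))"
    using assms by auto
  have "fst s \<le> d div 2" "snd s < n (fst s)" "fst s \<le> f"
    using starts_bound[OF s] by auto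
  then show "string_elt (s, f - fst s) \<in> hom_part f"
    using string_elt_hom[of "fst s" "snd s" "f - fst s"] by simp
qed

text \<open>The sets \<open>S\<close> contain only strings that meet both degree \<open>f\<close> and degree \<open>d - f\<close>, which is why they are
  bounded by the minimum.\<close>

lemma string_proj_orthogonal:
  assumes "S \<subseteq> starts (min f (d - f))" "f \<le> d" and t: "t \<in> starts (min f (d - f))"
  shows "\<psi> (string_proj f S w * string_elt (t, d - f - fst t)) =
    (if t \<in> S then \<psi> (w * string_elt (t, d - f - fst t)) else 0)"
proof -
  have "finite S"
    using assms(1) finite_starts finite_subset by blast
  have pair: "\<psi> (string_elt (s, f - fst s) * string_elt (t, d - f - fst t)) \<noteq> 0 \<longleftrightarrow> s = t"
    if "s \<in> starts (min f (d - f))" for s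
  proof -
    have s: "fst s \<le> d div 2" "snd s < n (fst s)" "fst s \<le> f" "fst s \<le> d - f"
      using starts_bound[of "fst s" "snd s" "min f (d - f)"] that by auto
    have t': "fst t \<le> d div 2" "snd t < n (fst t)"
      using starts_bound[of "fst t" "snd t" "min f (d - f)"] t by auto
    show ?thesis
      using string_pairing[OF s(1,2) t', of "f - fst s" "d - f - fst t"] s(3,4) assms(2)
      by (auto simp: prod_eq_iff)
  qed
  have "\<psi> (string_proj f S w * string_elt (t, d - f - fst t)) =
      (\<Sum>s\<in>S. string_coeff f w s * \<psi> (string_elt (s, f - fst s) * string_elt (t, d - f - fst t)))"
    by (simp add: string_proj_def sum_distrib_right psi_sum psi_scale mult.assoc)
  also have "\<dots> = (\<Sum>s\<in>S. if s = t then \<psi> (w * string_elt (t, d - f - fst t)) else 0)"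
    by (rule sum.cong[OF refl]) (use pair assms(1) in \<open>auto simp: string_coeff_def subset_iff\<close>)
  also have "\<dots> = (if t \<in> S then \<psi> (w * string_elt (t, d - f - fst t)) else 0)"
    using \<open>finite S\<close> by (auto simp: sum.delta)
  finally show ?thesis .
qed

lemma diff_proj_orthogonal:
  assumes "S \<subseteq> starts (min f (d - f))" "f \<le> d" "t \<in> S"
  shows "\<psi> ((w - string_proj f S w) * string_elt (t, d - f - fst t)) = 0"
  using string_proj_orthogonal[OF assms(1,2), of t w] assms(1,3)
  by (auto simp: left_diff_distrib psi_diff)

text \<open>The power of \<open>l\<close> in the form of degree \<open>e\<close> carries a string vector of degree \<open>e\<close> to its partner.\<close>

lemma lform_string_elt:
  assumes "fst s \<le> e" "e \<le> d div 2"
  shows "lform e x (string_elt (s, e - fst s)) = \<psi> (x * string_elt (s, d - e - fst s))"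
proof -
  have "d - e - fst s = (d - 2 * e) + (e - fst s)"
    using assms by linarith
  then show ?thesis
    by (simp add: lform_def string_elt_def power_add split_beta mult_ac)
qed

text \<open>Induction on the degree. By the induction hypothesis the strings starting below \<open>e\<close> span
  \<open>l * A\<^bsub>e-1\<^esub>\<close> in degree \<open>e\<close>, and subtracting the projection onto them leaves a primitive element. The
  remainder \<open>x\<close> after subtracting the full projection is thus primitive and orthogonal to the strings
  from below, and by maximality to all primitive elements; together these are everything, so
  nondegeneracy puts \<open>x\<close> into the annihilator.\<close>

lemma low_degree_proj:
  assumes "e \<le> d div 2" "w \<in> hom_part e"
  shows "w - string_proj e (starts e) w \<in> ann F"
  using assms
proof (induction e arbitrary: w rule: less_induct)
  case (less e)
  have e: "e \<le> d" "min e (d - e) = e"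
    using less.prems(1) by auto
  \<comment> \<open>the strings entering degree \<open>e\<close> from below\<close>
  define low where "low = starts e - {e} \<times> UNIV"
  have low: "low \<subseteq> starts e"
    by (auto simp: low_def)
  have prim: "u - string_proj e low u \<in> primitive e" if u: "u \<in> hom_part e" for u
  proof -
    let ?y = "u - string_proj e low u"
    have y: "?y \<in> hom_part e"
      using string_proj_hom[of low e u] low e u by (simp add: hom_part_diff)
    have "l ^ (d + 1 - 2 * e) * ?y \<in> ann F"
    proof (rule ann_homI[OF hom_part_l_power[OF y]])
      fix q :: "('n, 'k) mpoly" assume *: "d + 1 - 2 * e + e \<le> d" "q \<in> hom_part (d - (d + 1 - 2 * e + e))"
      have e0: "e > 0" and "d - (d + 1 - 2 * e + e) = e - 1"
        using *(1) less.prems(1) by linarith+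
      then have q: "q \<in> hom_part (e - 1)"
        using * by simp
      have "q - string_proj (e - 1) (starts (e - 1)) q \<in> ann F"
        by (rule less.IH) (use e0 less.prems(1) q in auto)
      then show "\<psi> (l ^ (d + 1 - 2 * e) * ?y * q) = 0"
        unfolding string_proj_def[of "e - 1"]
      proof (rule psi_span_zero)
        fix s assume s: "s \<in> starts (e - 1)"
        then have s': "fst s \<le> e - 1" "s \<in> low"
          using e0 by (auto simp: starts_def low_def)
        have "d - e - fst s = (d + 1 - 2 * e) + (e - 1 - fst s)"
          using s' e0 less.prems(1) by linarith
        then have "l ^ (d + 1 - 2 * e) * ?y * string_elt (s, e - 1 - fst s) =
            ?y * string_elt (s, d - e - fst s)"
          by (simp add: string_elt_def power_add split_beta mult_ac)
        then show "\<psi> (l ^ (d + 1 - 2 * e) * ?y * string_elt (s, e - 1 - fst s)) = 0"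
          using diff_proj_orthogonal[of low e s u] low e s'(2) by simp
      qed
    qed
    then show ?thesis
      using y by (simp add: primitive_def)
  qed
  define x where "x = w - string_proj e (starts e) w"
  have x_orth: "\<psi> (x * string_elt (s, d - e - fst s)) = 0" if "s \<in> starts e" for s
    using diff_proj_orthogonal[of "starts e" e s w] that e by (simp add: x_def)
  have x_hom: "x \<in> hom_part e"
    using string_proj_hom[of "starts e" e w] e less.prems by (simp add: x_def hom_part_diff)
  have x_prim: "x \<in> primitive e"
  proof -
    have split: "starts e = low \<union> {e} \<times> {..<n e}" "low \<inter> {e} \<times> {..<n e} = {}"
      by (auto simp: low_def starts_def)
    have "string_proj e (starts e) w = string_proj e low w + string_proj e ({e} \<times> {..<n e}) w"
      unfolding string_proj_def split(1)
      by (rule sum.union_disjoint) (use split(2) in \<open>auto simp: low_def\<close>)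
    then have "x = (w - string_proj e low w) - string_proj e ({e} \<times> {..<n e}) w"
      by (simp add: x_def)
    moreover have "string_proj e ({e} \<times> {..<n e}) w \<in> primitive e"
      unfolding string_proj_def
      by (intro primitive_sum primitive_scale)
         (use less.prems(1) v_primitive in \<open>auto simp: string_elt_def\<close>)
    ultimately show ?thesis
      using primitive_diff prim[OF less.prems(2)] by simp
  qed
  have x_lform: "lform e x p = 0" if "p \<in> primitive e" for p
  proof (rule maximal[OF less.prems(1) x_prim _ that])
    fix j assume "j < n e"
    then show "lform e x (v e j) = 0"
      using x_orth[of "(e, j)"] lform_string_elt[of "(e, j)" e x] less.prems(1)
      by (simp add: starts_def string_elt_def)
  qed
  have "x \<in> ann F"
  proof (rule nondegenerate[OF less.prems(1) x_hom])
    fix q :: "('n, 'k) mpoly" assume q: "q \<in> hom_part e"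
    have "lform e x (string_proj e low q) = 0"
    proof -
      have "lform e x (string_elt (s, e - fst s)) = 0" if "s \<in> low" for s
        using x_orth[of s] lform_string_elt[of s e x] that less.prems(1)
        by (auto simp: low_def starts_def)
      then show ?thesis
        unfolding string_proj_def lform_commute[of e x] lform_sum lform_scale by simp
    qed
    moreover have "lform e x (q - string_proj e low q) = 0"
      by (rule x_lform[OF prim[OF q]])
    ultimately have "lform e x q = 0"
      by (simp add: lform_diff lform_commute[of e x])
    then show "\<psi> (l ^ (d - 2 * e) * (x * q)) = 0"
      by (simp add: lform_def)
  qed
  then show ?case
    by (simp add: x_def)
qed

text \<open>Above the middle degree the remainder is tested against forms of degree \<open>d - f \<le> d div 2\<close>, which are
  already known to be combinations of strings.\<close>

lemma hom_proj:
  assumes "f \<le> d" "w \<in> hom_part f"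
  shows "w - string_proj f (starts (min f (d - f))) w \<in> ann F"
proof (rule ann_homI)
  show "w - string_proj f (starts (min f (d - f))) w \<in> hom_part f"
    using assms string_proj_hom by (simp add: hom_part_diff)
  fix q :: "('n, 'k) mpoly" assume q: "q \<in> hom_part (d - f)"
  show "\<psi> ((w - string_proj f (starts (min f (d - f))) w) * q) = 0"
  proof (cases "f \<le> d div 2")
    case True
    then have "min f (d - f) = f" by linarith
    then show ?thesis
      using ann_psi[OF low_degree_proj[OF True assms(2)]] by simp
  next
    case False
    then have "min f (d - f) = d - f" "d - f \<le> d div 2"
      by linarith+
    from low_degree_proj[OF this(2) q] show ?thesis
      unfolding string_proj_def[of "d - f"]
    proof (rule psi_span_zero)
      fix s assume "s \<in> starts (d - f)"
      then show "\<psi> ((w - string_proj f (starts (min f (d - f))) w) * string_elt (s, d - f - fst s)) = 0"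
        using diff_proj_orthogonal[of "starts (min f (d - f))" f s w] assms(1) \<open>min f (d - f) = d - f\<close>
        by simp
    qed
  qed
qed

definition string_index_set :: "((nat \<times> nat) \<times> nat) set" where
  "string_index_set = (SIGMA s:starts (d div 2). {..<d + 1 - 2 * fst s})"

lemma finite_string_index_set [simp]: "finite string_index_set"
  by (simp add: string_index_set_def)

lemma string_elts_span:
  "\<exists>c. w - (\<Sum>t\<in>string_index_set. mconst (c t) * string_elt t) \<in> ann F"
proof (induction w rule: poly_mapping_sum_induct)
  case zero
  show ?case
    by (rule exI[of _ "\<lambda>_. 0"]) (simp add: ann_zero)
next
  case (add m a q)
  let ?w = "Poly_Mapping.single m a" and ?f = "mdeg m"
  have w: "?w \<in> hom_part ?f"
    by (rule hom_part_single) simp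
  have "\<exists>c. ?w - (\<Sum>t\<in>string_index_set. mconst (c t) * string_elt t) \<in> ann F"
  proof (cases "?f \<le> d")
    case False
    have "?w \<in> ann F"
      by (rule ann_homI[OF w]) (use False in auto)
    then show ?thesis
      by (intro exI[of _ "\<lambda>_. 0"]) simp
  next
    case True
    let ?S = "starts (min ?f (d - ?f))"
    let ?h = "\<lambda>s. (s, ?f - fst s)"
    \<comment> \<open>the projection in degree \<open>mdeg m\<close>, extended by zero to the other string vectors\<close>
    define c where "c t = (if t \<in> ?h ` ?S then string_coeff ?f ?w (fst t) else 0)" for t
    have sub: "?h ` ?S \<subseteq> string_index_set"
      using True by (auto simp: string_index_set_def starts_def)
    have "(\<Sum>t\<in>string_index_set. mconst (c t) * string_elt t) =
        (\<Sum>t\<in>?h ` ?S. mconst (c t) * string_elt t)"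
      by (rule sum.mono_neutral_right) (use sub in \<open>auto simp: c_def\<close>)
    also have "\<dots> = string_proj ?f ?S ?w"
      unfolding string_proj_def
      by (subst sum.reindex) (auto simp: inj_on_def c_def intro!: sum.cong)
    finally show ?thesis
      using hom_proj[OF True w] by (intro exI[of _ c]) simp
  qed
  with add obtain c c' where
    "?w - (\<Sum>t\<in>string_index_set. mconst (c t) * string_elt t) \<in> ann F"
    "q - (\<Sum>t\<in>string_index_set. mconst (c' t) * string_elt t) \<in> ann F" by blast
  from ann_add[OF this] show ?case
    by (intro exI[of _ "\<lambda>t. c t + c' t"])
       (simp add: mconst_add distrib_right sum.distrib algebra_simps)
qed

lemma string_elts_independent:
  assumes "(\<Sum>t\<in>string_index_set. mconst (c t) * string_elt t) \<in> ann F" "t \<in> string_index_set"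
  shows "c t = 0"
proof (rule independent_of_dual_family[OF finite_string_index_set _ assms])
  fix s t assume "s \<in> string_index_set" "t \<in> string_index_set"
  moreover obtain i j k i' j' k' where "s = ((i, j), k)" "t = ((i', j'), k')"
    by (metis prod.collapse)
  ultimately show "\<psi> (string_elt s * (\<lambda>t. string_elt (fst t, d - 2 * fst (fst t) - snd t)) t) \<noteq> 0 \<longleftrightarrow> s = t"
    using string_pairing[of i j i' j' k "d - 2 * i' - k'"]
    by (auto simp: string_index_set_def starts_def)
qed

lemma string_elts_basis:
  assumes "distinct ts" "set ts = string_index_set"
  shows "is_basis F (map (\<lambda>t. cls F (string_elt t)) ts) (carrier (alg F))"
  unfolding carrier_alg
  by (rule is_basisI) (use assms string_elts_span string_elts_independent in auto)

text \<open>Up to the middle degree \<open>e\<close>, each string that starts in degree at most \<open>e\<close> contributes exactly one basis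
  vector to degree \<open>e\<close>.\<close>

lemma h_vec_eq_sum:
  assumes e: "e \<le> d div 2"
  shows "h_vec F e = (\<Sum>i\<le>e. n i)"
proof -
  obtain ts where ts: "distinct ts" "set ts = starts e"
    using finite_distinct_list[OF finite_starts] by blast
  have "is_basis F (map (\<lambda>s. cls F (string_elt (s, e - fst s))) ts) (cls F ` hom_part e)"
  proof (rule is_basisI[OF ts(1)])
    show "(\<Sum>s\<in>set ts. mconst (c s) * string_elt (s, e - fst s)) \<in> hom_part e" for c
    proof (intro hom_part_sum hom_part_scale)
      fix s assume "s \<in> set ts"
      then show "string_elt (s, e - fst s) \<in> hom_part e"
        using string_elt_hom[of "fst s" "snd s" "e - fst s"] starts_bound[of "fst s" "snd s" e] e
        by (auto simp: ts)
    qed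
    show "\<exists>c. w - (\<Sum>s\<in>set ts. mconst (c s) * string_elt (s, e - fst s)) \<in> ann F"
      if "w \<in> hom_part e" for w
      using low_degree_proj[OF e that] by (auto simp: ts string_proj_def)
    fix c s assume "(\<Sum>s\<in>set ts. mconst (c s) * string_elt (s, e - fst s)) \<in> ann F" "s \<in> set ts"
    then show "c s = 0"
    proof (rule independent_of_dual_family[OF finite_set, rotated])
      fix s t assume "s \<in> set ts" "t \<in> set ts"
      then have "fst s \<le> d div 2" "snd s < n (fst s)" "fst s \<le> e"
        "fst t \<le> d div 2" "snd t < n (fst t)" "fst t \<le> e"
        using starts_bound[of "fst s" "snd s" e] starts_bound[of "fst t" "snd t" e] e by (auto simp: ts)
      then show "\<psi> (string_elt (s, e - fst s) * (\<lambda>s. string_elt (s, d - e - fst s)) t) \<noteq> 0 \<longleftrightarrow> s = t"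
        using string_pairing[of "fst s" "snd s" "fst t" "snd t" "e - fst s" "d - e - fst t"] e
        by (auto simp: prod_eq_iff)
    qed
  qed
  then have "h_vec F e = length ts"
    using h_vec_eq_length by (simp add: graded_part_def)
  also have "\<dots> = card (starts e)"
    using distinct_card[OF ts(1)] ts(2) by simp
  also have "\<dots> = (\<Sum>i\<le>e. n i)"
    by (simp add: starts_def)
  finally show ?thesis .
qed

lemma h_diff_eq:
  assumes "e \<le> d div 2"
  shows "h_diff F e = int (n e)"
proof (cases e)
  case 0
  then show ?thesis by (simp add: h_diff_def h_vec_eq_sum)
next
  case (Suc e')
  then show ?thesis
    using assms by (simp add: h_diff_def h_vec_eq_sum)
qed

lemma jordan_type:
  "has_jordan_type F (cls F l) (\<Sum>i\<le>d div 2. replicate_mset (n i) (d + 1 - 2 * i))"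
proof -
  let ?D = "[0..<Suc (d div 2)]"
  define ss where "ss = concat (map (\<lambda>i. map (Pair i) [0..<n i]) ?D)"
  define len where "len = (\<lambda>s :: nat \<times> nat. d + 1 - 2 * fst s)"
  have "distinct (concat (map (\<lambda>i. map (Pair i) [0..<n i]) [0..<N]))" for N
    by (induction N) (auto simp: distinct_map inj_on_def)
  then have ss: "set ss = starts (d div 2)" "distinct ss"
    unfolding ss_def by (auto simp: starts_def less_Suc_eq_le simp del: upt_Suc)
  have len_pos: "len s > 0" if "s \<in> set ss" for s
    using that by (auto simp: ss starts_def len_def)
  have "set (string_indices len ss) = string_index_set"
    by (auto simp: string_indices_def string_index_set_def ss len_def)
  moreover have "distinct (string_indices len ss)"
    using ss(2) unfolding string_indices_def
    by (induction ss) (auto simp: distinct_map inj_on_def)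
  ultimately have "is_basis F (map (\<lambda>t. cls F (string_elt t)) (string_indices len ss)) (carrier (alg F))"
    by (intro string_elts_basis)
  then have "has_jordan_type F (cls F l) (mset (map len ss))"
  proof (rule has_jordan_type_strings)
    show "l * string_elt (s, k) = string_elt (s, Suc k)" for s k
      by (simp add: string_elt_def split_beta mult.assoc)
    show "l * string_elt (s, len s - 1) \<in> ann F" if "s \<in> set ss" for s
    proof -
      have s: "fst s \<le> d div 2" "snd s < n (fst s)"
        using that by (auto simp: ss starts_def)
      have "l * string_elt (s, len s - 1) = l ^ len s * v (fst s) (snd s)"
        using len_pos[OF that]
        by (simp add: string_elt_def split_beta power_Suc[symmetric] mult.assoc[symmetric] del: power_Suc)
      then show ?thesis
        using l_power_v_ann[OF s, of "len s"] s by (simp add: len_def)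
    qed
  qed (rule len_pos)
  also have "map len ss = concat (map (\<lambda>i. replicate (n i) (d + 1 - 2 * i)) ?D)"
    by (simp only: ss_def map_concat map_map comp_def len_def fst_conv map_replicate_const
        length_upt diff_zero)
  also have "mset \<dots> = (\<Sum>i\<le>d div 2. replicate_mset (n i) (d + 1 - 2 * i))"
    by (simp only: mset_concat map_map comp_def mset_replicate interv_sum_list_conv_sum_set_nat
        set_upt atLeast0LessThan lessThan_Suc_atMost)
  finally show ?thesis .
qed

end

text \<open>The numbers of strings depend on the chosen bases only through the \<open>h\<close>-vector, so all strong Lefschetz
  elements share one Jordan type.\<close>

theorem (in lefschetz) jordan_type_h_diff:
  "has_jordan_type F (cls F l) (\<Sum>i\<le>d div 2. replicate_mset (nat (h_diff F i)) (d + 1 - 2 * i))"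
  "i \<le> d div 2 \<Longrightarrow> h_diff F i \<ge> 0"
proof -
  obtain n v where nv: "\<And>e. e \<le> d div 2 \<Longrightarrow> orthogonal_family e (n e) (v e)"
    "\<And>e x p. e \<le> d div 2 \<Longrightarrow> x \<in> primitive e \<Longrightarrow>
      (\<And>j. j < n e \<Longrightarrow> lform e x (v e j) = 0) \<Longrightarrow> p \<in> primitive e \<Longrightarrow> lform e x p = 0"
    using primitive_bases_exist by metis
  interpret primitive_bases F \<psi> d l n v
    by unfold_locales (use nv in blast)+
  show "has_jordan_type F (cls F l) (\<Sum>i\<le>d div 2. replicate_mset (nat (h_diff F i)) (d + 1 - 2 * i))"
    using jordan_type by (simp add: h_diff_eq)
  show "h_diff F i \<ge> 0" if "i \<le> d div 2"
    using that by (simp add: h_diff_eq)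
qed

section \<open>Gram matrices\<close>

text \<open>Nonvanishing of determinants is the form in which openness is proved; trivial kernel is the form in
  which Gram matrices are used.\<close>

lemma det_mat_nonzero_iff:
  fixes f :: "nat \<times> nat \<Rightarrow> 'k::field"
  shows "det (mat q q f) \<noteq> 0 \<longleftrightarrow>
    (\<forall>c. (\<forall>i<q. (\<Sum>j<q. f (i, j) * c j) = 0) \<longrightarrow> (\<forall>j<q. c j = 0))"
proof -
  have mult: "mat q q f *\<^sub>v x = 0\<^sub>v q \<longleftrightarrow> (\<forall>i<q. (\<Sum>j<q. f (i, j) * (x $ j)) = 0)"
    if "x \<in> carrier_vec q" for x
    using that by (auto simp: vec_eq_iff scalar_prod_def atLeast0LessThan)
  have "det (mat q q f) = 0 \<longleftrightarrow>
      (\<exists>x. x \<in> carrier_vec q \<and> x \<noteq> 0\<^sub>v q \<and> mat q q f *\<^sub>v x = 0\<^sub>v q)"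
    by (rule det_0_iff_vec_prod_zero_field) simp
  also have "\<dots> \<longleftrightarrow> (\<exists>c. (\<forall>i<q. (\<Sum>j<q. f (i, j) * c j) = 0) \<and> (\<exists>j<q. c j \<noteq> 0))"
  proof safe
    fix x assume x: "x \<in> carrier_vec q" "x \<noteq> 0\<^sub>v q" "mat q q f *\<^sub>v x = 0\<^sub>v q"
    then have "\<exists>j<q. x $ j \<noteq> 0"
      by (auto simp: vec_eq_iff)
    with x mult[OF x(1)] show "\<exists>c. (\<forall>i<q. (\<Sum>j<q. f (i, j) * c j) = 0) \<and> (\<exists>j<q. c j \<noteq> 0)"
      by (intro exI[of _ "\<lambda>j. x $ j"]) simp
  next
    fix c j assume c: "\<forall>i<q. (\<Sum>j<q. f (i, j) * c j) = 0" "j < q" "c j \<noteq> 0"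
    have "(\<Sum>j<q. f (i, j) * (vec q c $ j)) = (\<Sum>j<q. f (i, j) * c j)" for i
      by (rule sum.cong) auto
    then show "\<exists>x. x \<in> carrier_vec q \<and> x \<noteq> 0\<^sub>v q \<and> mat q q f *\<^sub>v x = 0\<^sub>v q"
      using c mult[of "vec q c"] by (intro exI[of _ "vec q c"]) (auto simp: vec_eq_iff)
  qed
  finally show ?thesis by blast
qed

lemma square_system_solvable:
  fixes f :: "nat \<times> nat \<Rightarrow> 'k::field"
  assumes "\<And>c j. (\<And>i. i < q \<Longrightarrow> (\<Sum>j<q. f (i, j) * c j) = 0) \<Longrightarrow> j < q \<Longrightarrow> c j = 0"
  shows "\<exists>c. \<forall>i<q. (\<Sum>j<q. f (i, j) * c j) = w i"
proof -
  let ?A = "mat q q f"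
  have A: "?A \<in> carrier_mat q q" by simp
  have det: "det ?A \<noteq> 0"
    unfolding det_mat_nonzero_iff using assms by blast
  \<comment> \<open>Cramer's rule\<close>
  define x where "x = (1 / det ?A) \<cdot>\<^sub>v (adj_mat ?A *\<^sub>v vec q w)"
  have adj: "adj_mat ?A \<in> carrier_mat q q" "?A * adj_mat ?A = det ?A \<cdot>\<^sub>m 1\<^sub>m q"
    using adj_mat[OF A] by auto
  have x: "x \<in> carrier_vec q"
    using adj by (auto simp: x_def)
  have "?A *\<^sub>v x = (1 / det ?A) \<cdot>\<^sub>v (?A *\<^sub>v (adj_mat ?A *\<^sub>v vec q w))"
    unfolding x_def by (rule mult_mat_vec[OF A]) (use adj in auto)
  also have "?A *\<^sub>v (adj_mat ?A *\<^sub>v vec q w) = (det ?A \<cdot>\<^sub>m 1\<^sub>m q) *\<^sub>v vec q w"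
    using assoc_mult_mat_vec[OF A adj(1), of "vec q w"] adj(2) by simp
  also have "\<dots> = det ?A \<cdot>\<^sub>v vec q w"
  proof -
    have "y * (if b then 1 else 0) * z = (if b then y * z else 0)" for b and y z :: 'k
      by simp
    then show ?thesis
      by (auto simp: vec_eq_iff scalar_prod_def)
  qed
  finally have "?A *\<^sub>v x = vec q w"
    using det by (simp add: smult_smult_assoc)
  then have "(\<Sum>j<q. f (i, j) * (x $ j)) = w i" if "i < q" for i
    using that x by (auto simp: vec_eq_iff scalar_prod_def atLeast0LessThan)
  then show ?thesis
    by (intro exI[of _ "\<lambda>j. x $ j"]) simp
qed

context macaulay_dual
begin

text \<open>The \<open>q\<close> coordinate functionals detect membership in the annihilator, so the degree \<open>e\<close> part has
  dimension at most \<open>q\<close>. A nonsingular \<open>q\<close> by \<open>q\<close> Gram matrix makes \<open>g\<close> independent modulo the annihilator,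
  hence a basis, and a form with nonsingular Gram matrix on a basis is nondegenerate.\<close>

lemma gram_det_imp_basis:
  assumes g: "\<And>i. i < q \<Longrightarrow> g i \<in> hom_part e"
    and det: "det (mat q q (\<lambda>(i, j). \<psi> (u * (g i * g j)))) \<noteq> 0"
    and add: "\<And>p p' x. coord (p + p') x = coord p x + (coord p' x :: 'k)"
    and scale: "\<And>c p x. coord (mconst c * p) x = c * coord p x"
    and inj: "\<And>p. p \<in> hom_part e \<Longrightarrow> (\<And>x. x < q \<Longrightarrow> coord p x = 0) \<Longrightarrow> p \<in> ann F"
  shows "(\<Sum>i<q. mconst (c i) * g i) \<in> ann F \<Longrightarrow> i < q \<Longrightarrow> c i = 0"
    and "w \<in> hom_part e \<Longrightarrow> \<exists>c. w - (\<Sum>i<q. mconst (c i) * g i) \<in> ann F"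
    and "w \<in> hom_part e \<Longrightarrow> (\<And>p. p \<in> hom_part e \<Longrightarrow> \<psi> (u * (w * p)) = 0) \<Longrightarrow> w \<in> ann F"
proof -
  have gram: "\<psi> (u * ((\<Sum>i<q. mconst (c i) * g i) * g j)) = (\<Sum>i<q. \<psi> (u * (g j * g i)) * c i)" for c j
    by (simp add: sum_distrib_left sum_distrib_right psi_sum mult.assoc
        mult.left_commute[of u "mconst _"] psi_scale mult.commute[of "g _" "g j"] mult.commute[of "c _"])
  have kernel: "c i = 0"
    if "\<And>j. j < q \<Longrightarrow> \<psi> (u * ((\<Sum>i<q. mconst (c i) * g i) * g j)) = 0" "i < q" for c i
    using det that unfolding det_mat_nonzero_iff gram by auto
  show indep: "c i = 0" if "(\<Sum>i<q. mconst (c i) * g i) \<in> ann F" "i < q" for c i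
    using kernel[of c i] that ann_psi[OF that(1)] by (simp add: mult.left_commute[of u])
  have coord_zero: "coord 0 x = 0" for x
    using scale[of 0 0] by simp
  have coord_sum: "coord (\<Sum>i\<in>I. mconst (c i) * g i) x = (\<Sum>i\<in>I. coord (g i) x * c i)" for c I x
    by (induction I rule: infinite_finite_induct) (simp_all add: add scale coord_zero mult.commute[of "coord _ _"])
  have coord_diff: "coord (p - p') x = coord p x - coord p' x" for p p' x
    using add[of "p - p'" p' x] by simp
  have hom_sum: "(\<Sum>i<q. mconst (c i) * g i) \<in> hom_part e" for c
    by (intro hom_part_sum hom_part_scale g) simp
  show span: "\<exists>c. w - (\<Sum>i<q. mconst (c i) * g i) \<in> ann F" if w: "w \<in> hom_part e" for w
  proof -
    have "\<exists>c. \<forall>x<q. (\<Sum>i<q. (\<lambda>(x, i). coord (g i) x) (x, i) * c i) = coord w x"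
    proof (rule square_system_solvable)
      fix c i assume "\<And>x. x < q \<Longrightarrow> (\<Sum>i<q. (\<lambda>(x, i). coord (g i) x) (x, i) * c i) = 0" and i: "i < q"
      then have "(\<Sum>i<q. mconst (c i) * g i) \<in> ann F"
        by (intro inj hom_sum) (simp add: coord_sum)
      then show "c i = 0"
        by (rule indep[OF _ i])
    qed
    then obtain c where c: "\<And>x. x < q \<Longrightarrow> (\<Sum>i<q. coord (g i) x * c i) = coord w x"
      by auto
    have "w - (\<Sum>i<q. mconst (c i) * g i) \<in> ann F"
      by (intro inj hom_part_diff w hom_sum) (simp add: coord_diff coord_sum c)
    then show ?thesis by blast
  qed
  show "w \<in> ann F" if w: "w \<in> hom_part e" "\<And>p. p \<in> hom_part e \<Longrightarrow> \<psi> (u * (w * p)) = 0" for w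
  proof -
    obtain c where c: "w - (\<Sum>i<q. mconst (c i) * g i) \<in> ann F"
      using span[OF w(1)] by blast
    have "c i = 0" if "i < q" for i
    proof (rule kernel[OF _ that])
      fix j assume "j < q"
      have "\<psi> (u * (w * g j)) = \<psi> (u * ((\<Sum>i<q. mconst (c i) * g i) * g j))"
        using psi_congruent[OF c, of "u * g j"] by (simp add: mult_ac)
      then show "\<psi> (u * ((\<Sum>i<q. mconst (c i) * g i) * g j)) = 0"
        using w(2)[OF g[OF \<open>j < q\<close>]] by simp
    qed
    then show ?thesis
      using c by simp
  qed
qed

end

section \<open>Monomials of a given degree\<close>

text \<open>Reduces counting monomials to counting lists of naturals with given length and sum.\<close>

lemma bij_betw_exponents_lists:
  assumes xs: "distinct xs" "set xs = (UNIV :: 'n::finite set)"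
  shows "bij_betw (\<lambda>m. map (Poly_Mapping.lookup m) xs) {m :: 'n \<Rightarrow>\<^sub>0 nat. mdeg m = e}
    {l. length l = CARD('n) \<and> sum_list l = e}"
proof (rule bij_betwI')
  have len: "length xs = CARD('n)"
    using distinct_card[OF xs(1)] xs(2) by simp
  fix m m' :: "'n \<Rightarrow>\<^sub>0 nat"
  show "(map (Poly_Mapping.lookup m) xs = map (Poly_Mapping.lookup m') xs) = (m = m')"
    using xs(2) by (auto intro: poly_mapping_eqI)
  show "map (Poly_Mapping.lookup m) xs \<in> {l. length l = CARD('n) \<and> sum_list l = e}"
    if "m \<in> {m. mdeg m = e}"
    using that by (simp add: len mdeg_UNIV sum_list_distinct_conv_sum_set[OF xs(1)] xs(2))
next
  have len: "length xs = CARD('n)"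
    using distinct_card[OF xs(1)] xs(2) by simp
  fix l :: "nat list" assume l: "l \<in> {l. length l = CARD('n) \<and> sum_list l = e}"
  define m where "m = Poly_Mapping.Abs_poly_mapping (\<lambda>j. the (map_of (zip xs l) j))"
  have m: "Poly_Mapping.lookup m j = the (map_of (zip xs l) j)" for j
    by (simp add: m_def)
  have eq: "map (Poly_Mapping.lookup m) xs = l"
    by (rule nth_equalityI) (use l len xs(1) in \<open>auto simp: m map_of_zip_nth\<close>)
  have "mdeg m = sum_list (map (Poly_Mapping.lookup m) xs)"
    by (simp add: mdeg_UNIV sum_list_distinct_conv_sum_set[OF xs(1)] xs(2))
  then show "\<exists>m\<in>{m. mdeg m = e}. l = map (Poly_Mapping.lookup m) xs"
    using eq l by auto
qed

lemma finite_exponents: "finite {m :: 'n::finite \<Rightarrow>\<^sub>0 nat. mdeg m = e}"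
  and card_exponents: "card {m :: 'n::finite \<Rightarrow>\<^sub>0 nat. mdeg m = e} = (CARD('n) - 1 + e) choose (CARD('n) - 1)"
proof -
  obtain xs :: "'n list" where xs: "distinct xs" "set xs = UNIV"
    using finite_distinct_list[OF finite_class.finite_UNIV] by blast
  have "{l :: nat list. length l = CARD('n) \<and> sum_list l = e} \<subseteq>
      {l. set l \<subseteq> {..e} \<and> length l = CARD('n)}"
    using member_le_sum_list by fastforce
  moreover have "finite {l :: nat list. set l \<subseteq> {..e} \<and> length l = CARD('n)}"
    by (rule finite_lists_length_eq) simp
  ultimately have "finite {l :: nat list. length l = CARD('n) \<and> sum_list l = e}"
    by (rule finite_subset)
  then show "finite {m :: 'n \<Rightarrow>\<^sub>0 nat. mdeg m = e}"
    using bij_betw_finite[OF bij_betw_exponents_lists[OF xs]] by blast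
  have "card {m :: 'n \<Rightarrow>\<^sub>0 nat. mdeg m = e} = (e + CARD('n) - 1) choose e"
    using bij_betw_same_card[OF bij_betw_exponents_lists[OF xs]] by (simp add: card_length_sum_list)
  also have "e + CARD('n) - 1 = (CARD('n) - 1) + e"
    using zero_less_card_finite[where 'a = 'n] by linarith
  also have "(CARD('n) - 1 + e) choose e = (CARD('n) - 1 + e) choose (CARD('n) - 1)"
    by (metis add_diff_cancel_right' binomial_symmetric le_add2)
  finally show "card {m :: 'n \<Rightarrow>\<^sub>0 nat. mdeg m = e} = (CARD('n) - 1 + e) choose (CARD('n) - 1)" .
qed

section \<open>Strong Lefschetz elements for sums of powers\<close>

text \<open>The largest rank that the form \<open>B\<^sub>e\<close> can have, given that it factors through \<open>s\<close> evaluations and through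
  the space of forms of degree \<open>e\<close>.\<close>

definition expected_h :: "'n::finite itself \<Rightarrow> nat \<Rightarrow> nat \<Rightarrow> nat" where
  "expected_h _ s e = min s (card {m :: 'n \<Rightarrow>\<^sub>0 nat. mdeg m = e})"

text \<open>Expressed through evaluations, so that it is visibly a polynomial both in the points \<open>a\<close> and in the
  values of \<open>l\<close>.\<close>

definition gram_det ::
  "nat \<Rightarrow> nat \<Rightarrow> nat \<Rightarrow> ('n::finite, 'k::field) mpoly \<Rightarrow> (nat \<Rightarrow> ('n, 'k) mpoly) \<Rightarrow> (nat \<times> 'n \<Rightarrow> 'k) \<Rightarrow> 'k"
  where "gram_det d s e l g a = det (mat (expected_h TYPE('n) s e) (expected_h TYPE('n) s e)
     (\<lambda>(i, j). \<Sum>k\<in>{1..s}. mpoly_eval l (\<lambda>x. a (k, x)) ^ (d - 2 * e) *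
        (mpoly_eval (g i) (\<lambda>x. a (k, x)) * mpoly_eval (g j) (\<lambda>x. a (k, x)))))"

definition forms_family :: "nat \<Rightarrow> (nat \<Rightarrow> ('n, 'k::zero) mpoly) set" where
  "forms_family e = {g. \<forall>i. g i \<in> hom_part e}"

lemma gram_det_dual_functional:
  assumes l: "l \<in> hom_part 1" and g: "g \<in> forms_family e" and e: "e \<le> d div 2"
  shows "gram_det d s e l g a = det (mat (expected_h TYPE('n) s e) (expected_h TYPE('n) s e)
     (\<lambda>(i, j). dual_functional d s a (l ^ (d - 2 * e) * (g i * (g j :: ('n::finite, 'k::field) mpoly)))))"
proof -
  have "l ^ (d - 2 * e) * (g i * g j) \<in> hom_part d" for i j
  proof -
    have "l ^ (d - 2 * e) * (g i * g j) \<in> hom_part ((d - 2 * e) * 1 + (e + e))"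
      using g by (intro hom_part_mult hom_part_power l) (auto simp: forms_family_def)
    also have "(d - 2 * e) * 1 + (e + e) = d"
      using e by linarith
    finally show ?thesis .
  qed
  then show ?thesis
    by (simp add: gram_det_def dual_functional_hom)
qed

locale power_sum_lefschetz =
  fixes d s :: nat and a :: "nat \<times> 'n::finite \<Rightarrow> 'k::field_char_0" and l :: "('n, 'k) mpoly"
  assumes s: "s \<ge> 1" and l: "l \<in> hom_part 1"
    and gram: "\<And>e. e \<le> d div 2 \<Longrightarrow> \<exists>g\<in>forms_family e. gram_det d s e l g a \<noteq> 0"
begin

abbreviation "F \<equiv> power_sum d s a"

sublocale macaulay_dual F "dual_functional d s a" d
proof
  show "\<exists>p. dual_functional d s a p \<noteq> 0"
  proof (rule ccontr)
    assume "\<not> ?thesis"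
    then have zero: "dual_functional d s a p = 0" for p by blast
    obtain g where g: "g \<in> forms_family 0" "gram_det d s 0 l g a \<noteq> 0"
      using gram[of 0] by auto
    have "expected_h TYPE('n) s 0 > 0"
      using s by (simp add: expected_h_def card_exponents)
    moreover have "(1 :: 'k) = 0" if "0 < expected_h TYPE('n) s 0"
      using g(2) that unfolding gram_det_dual_functional[OF l g(1) le0] det_mat_nonzero_iff
      by (auto simp: zero dest: spec[of _ "\<lambda>_. 1"])
    ultimately show False by simp
  qed
qed (simp_all add: dual_functional_add dual_functional_scale dual_functional_other_degree
      ann_power_sum_iff)

text \<open>The coordinates detecting the annihilator are the values at the \<open>s\<close> points if \<open>s\<close> is at most the number of
  monomials of degree \<open>e\<close>, and the coefficients of these monomials otherwise.\<close>

lemma gram_basis: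
  assumes e: "e \<le> d div 2"
  obtains g where "\<And>i. g i \<in> hom_part e"
    "\<And>c i. (\<Sum>i<expected_h TYPE('n) s e. mconst (c i) * g i) \<in> ann F \<Longrightarrow>
       i < expected_h TYPE('n) s e \<Longrightarrow> c i = 0"
    "\<And>w. w \<in> hom_part e \<Longrightarrow> \<exists>c. w - (\<Sum>i<expected_h TYPE('n) s e. mconst (c i) * g i) \<in> ann F"
    "\<And>w. w \<in> hom_part e \<Longrightarrow> (\<And>p. p \<in> hom_part e \<Longrightarrow>
       dual_functional d s a (l ^ (d - 2 * e) * (w * p)) = 0) \<Longrightarrow> w \<in> ann F"
proof -
  obtain g where g: "g \<in> forms_family e" "gram_det d s e l g a \<noteq> 0"
    using gram[OF e] by blast
  have hom: "g i \<in> hom_part e" for i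
    using g by (simp add: forms_family_def)
  note det = g(2)[unfolded gram_det_dual_functional[OF l g(1) e]]
  let ?N = "card {m :: 'n \<Rightarrow>\<^sub>0 nat. mdeg m = e}"
  show ?thesis
  proof (cases "s \<le> ?N")
    case True
    then have q: "expected_h TYPE('n) s e = s"
      by (simp add: expected_h_def)
    let ?coord = "\<lambda>p x. mpoly_eval p (\<lambda>y. a (Suc x, y))"
    have inj: "p \<in> ann F" if p: "p \<in> hom_part e" "\<And>x. x < expected_h TYPE('n) s e \<Longrightarrow> ?coord p x = 0" for p
    proof (rule ann_homI[OF p(1)])
      fix r :: "('n, 'k) mpoly" assume "e \<le> d" and r: "r \<in> hom_part (d - e)"
      have "mpoly_eval p (\<lambda>y. a (k, y)) = 0" if "k \<in> {1..s}" for k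
      proof -
        have "k - 1 < s" "Suc (k - 1) = k"
          using that by auto
        then show ?thesis
          using p(2)[of "k - 1"] by (simp add: q)
      qed
      moreover have "p * r \<in> hom_part d"
        using hom_part_mult[OF p(1) r] \<open>e \<le> d\<close> by simp
      ultimately show "dual_functional d s a (p * r) = 0"
        by (simp add: dual_functional_hom)
    qed
    show ?thesis
    proof (rule that[of g, OF hom])
      note basis = gram_det_imp_basis[where coord = ?coord, OF hom det _ _ inj]
      show "c i = 0" if "(\<Sum>i<expected_h TYPE('n) s e. mconst (c i) * g i) \<in> ann F"
        "i < expected_h TYPE('n) s e" for c i
        by (rule basis(1)[OF _ _ _ _ that]) (simp_all add: q)
      show "\<exists>c. w - (\<Sum>i<expected_h TYPE('n) s e. mconst (c i) * g i) \<in> ann F"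
        if "w \<in> hom_part e" for w
        by (rule basis(2)[OF _ _ _ _ that]) (simp_all add: q)
      show "w \<in> ann F" if "w \<in> hom_part e" "\<And>p. p \<in> hom_part e \<Longrightarrow>
        dual_functional d s a (l ^ (d - 2 * e) * (w * p)) = 0" for w
        by (rule basis(3)[OF _ _ _ _ that]) (simp_all add: q)
    qed
  next
    case False
    then have q: "expected_h TYPE('n) s e = ?N"
      by (simp add: expected_h_def)
    obtain ms where ms: "set ms = {m :: 'n \<Rightarrow>\<^sub>0 nat. mdeg m = e}" "distinct ms"
      using finite_distinct_list[OF finite_exponents] by blast
    have N: "?N = length ms"
      using distinct_card[OF ms(2)] ms(1) by simp
    let ?coord = "\<lambda>p x. Poly_Mapping.lookup p (ms ! x)"
    have inj: "p \<in> ann F" if p: "p \<in> hom_part e" "\<And>x. x < expected_h TYPE('n) s e \<Longrightarrow> ?coord p x = 0" for p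
    proof -
      have "Poly_Mapping.lookup p m = 0" for m
      proof (cases "mdeg m = e")
        case True
        then have "m \<in> set ms"
          by (simp add: ms(1))
        then obtain x where "x < length ms" "ms ! x = m"
          unfolding in_set_conv_nth by blast
        then show ?thesis
          using p(2)[of x] by (simp add: q N)
      next
        case False
        then show ?thesis
          using p(1) by (auto simp: hom_part_iff)
      qed
      then have "p = 0"
        by (intro poly_mapping_eqI) simp
      then show ?thesis
        by (simp add: ann_zero)
    qed
    show ?thesis
    proof (rule that[of g, OF hom])
      note basis = gram_det_imp_basis[where coord = ?coord, OF hom det _ _ inj]
      show "c i = 0" if "(\<Sum>i<expected_h TYPE('n) s e. mconst (c i) * g i) \<in> ann F"
        "i < expected_h TYPE('n) s e" for c i
        by (rule basis(1)[OF _ _ _ _ that]) (simp_all add: q lookup_add)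
      show "\<exists>c. w - (\<Sum>i<expected_h TYPE('n) s e. mconst (c i) * g i) \<in> ann F"
        if "w \<in> hom_part e" for w
        by (rule basis(2)[OF _ _ _ _ that]) (simp_all add: q lookup_add)
      show "w \<in> ann F" if "w \<in> hom_part e" "\<And>p. p \<in> hom_part e \<Longrightarrow>
        dual_functional d s a (l ^ (d - 2 * e) * (w * p)) = 0" for w
        by (rule basis(3)[OF _ _ _ _ that]) (simp_all add: q lookup_add)
    qed
  qed
qed

lemma graded_part_basis:
  assumes "e \<le> d div 2"
  shows "\<exists>Us. is_basis F Us (graded_part F e) \<and> length Us = expected_h TYPE('n) s e"
proof -
  obtain g where g: "\<And>i. g i \<in> hom_part e"
    "\<And>c i. (\<Sum>i<expected_h TYPE('n) s e. mconst (c i) * g i) \<in> ann F \<Longrightarrow>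
       i < expected_h TYPE('n) s e \<Longrightarrow> c i = 0"
    "\<And>w. w \<in> hom_part e \<Longrightarrow> \<exists>c. w - (\<Sum>i<expected_h TYPE('n) s e. mconst (c i) * g i) \<in> ann F"
    by (rule gram_basis[OF assms]) (rule that)
  let ?ts = "[0..<expected_h TYPE('n) s e]"
  have "is_basis F (map (\<lambda>i. cls F (g i)) ?ts) (cls F ` hom_part e)"
    by (rule is_basisI)
       (use g in \<open>auto simp: atLeast0LessThan intro!: hom_part_sum hom_part_scale\<close>)
  then show ?thesis
    by (intro exI[of _ "map (\<lambda>i. cls F (g i)) ?ts"]) (simp add: graded_part_def)
qed

lemma h_vec_power_sum: "e \<le> d div 2 \<Longrightarrow> h_vec F e = expected_h TYPE('n) s e"
  using graded_part_basis h_vec_eq_length by metis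

sublocale lefschetz F "dual_functional d s a" d l
proof
  show "\<exists>Us. is_basis F Us (graded_part F e)" if "e \<le> d div 2" for e
    using graded_part_basis[OF that] by blast
  show "w \<in> ann F" if "e \<le> d div 2" "w \<in> hom_part e"
    "\<And>p. p \<in> hom_part e \<Longrightarrow> dual_functional d s a (l ^ (d - 2 * e) * (w * p)) = 0" for e w
    by (rule gram_basis[OF that(1)]) (use that(2,3) in blast)
qed (rule l)

end

section \<open>Points and forms realising a nonsingular Gram matrix\<close>

abbreviation sum_of_vars :: "('n::finite, 'k::comm_ring_1) mpoly" where
  "sum_of_vars \<equiv> lin_form (\<lambda>_. 1)"

text \<open>The exponents of degree \<open>e\<close>, read as points, are the lattice points of a simplex. On them the sum of the
  variables equals \<open>e\<close>, so the factor for \<open>j\<close> and \<open>t\<close> takes the value \<open>e * (x j - t)\<close> while being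
  homogeneous.\<close>

definition lattice_form :: "nat \<Rightarrow> ('n::finite \<Rightarrow>\<^sub>0 nat) \<Rightarrow> ('n, 'k::comm_ring_1) mpoly" where
  "lattice_form e m = (\<Prod>j\<in>UNIV. \<Prod>t<Poly_Mapping.lookup m j.
     lin_form (\<lambda>i. (if i = j then of_nat e else 0) - of_nat t))"

lemma lattice_form_hom:
  "(lattice_form e m :: ('n::finite, 'k::comm_ring_1) mpoly) \<in> hom_part (mdeg m)"
proof -
  have "(\<Prod>t<Poly_Mapping.lookup m j. lin_form (\<lambda>i. (if i = j then of_nat e else 0) - of_nat t))
      \<in> (hom_part (\<Sum>t<Poly_Mapping.lookup m j. 1) :: ('n, 'k) mpoly set)" for j
    by (rule hom_part_prod) (rule hom_part_lin_form)
  then have "(lattice_form e m :: ('n, 'k) mpoly) \<in>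
      hom_part (\<Sum>j\<in>UNIV. \<Sum>t<Poly_Mapping.lookup m j. 1)"
    unfolding lattice_form_def by (rule hom_part_prod)
  then show ?thesis
    by (simp add: mdeg_UNIV)
qed

text \<open>No factor vanishes at \<open>p\<close> precisely if \<open>p\<close> dominates \<open>m\<close> in every variable, and two exponents of the same
  degree are then equal.\<close>

lemma lattice_form_eval_nonzero_iff:
  fixes m p :: "'n::finite \<Rightarrow>\<^sub>0 nat"
  assumes "mdeg m = e" "mdeg p = e" "e > 0"
  shows "mpoly_eval (lattice_form e m) (\<lambda>j. of_nat (Poly_Mapping.lookup p j)) \<noteq> (0 :: 'k::field_char_0) \<longleftrightarrow> m = p"
proof -
  have sum: "(\<Sum>i\<in>UNIV. of_nat (Poly_Mapping.lookup p i)) = (of_nat e :: 'k)"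
    using assms(2) by (simp add: mdeg_UNIV flip: of_nat_sum)
  have lin: "(\<Sum>i\<in>UNIV. ((if i = j then of_nat e else 0) - of_nat t) * of_nat (Poly_Mapping.lookup p i)) =
      of_nat e * (of_nat (Poly_Mapping.lookup p j) - of_nat t :: 'k)" for j t
  proof -
    have "(\<Sum>i\<in>UNIV. ((if i = j then of_nat e else 0) - of_nat t) * of_nat (Poly_Mapping.lookup p i)) =
       (\<Sum>i\<in>UNIV. (if i = j then of_nat e * of_nat (Poly_Mapping.lookup p i) else 0) -
          of_nat t * of_nat (Poly_Mapping.lookup p i) :: 'k)"
      by (rule sum.cong) (auto simp: left_diff_distrib)
    also have "\<dots> = of_nat e * of_nat (Poly_Mapping.lookup p j) - of_nat t * of_nat e"
      by (simp add: sum_subtractf flip: sum_distrib_left sum)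
    finally show ?thesis
      by (simp add: algebra_simps)
  qed
  have "mpoly_eval (lattice_form e m) (\<lambda>j. of_nat (Poly_Mapping.lookup p j)) \<noteq> (0 :: 'k) \<longleftrightarrow>
      (\<forall>j. \<forall>t<Poly_Mapping.lookup m j. Poly_Mapping.lookup p j \<noteq> t)"
    using assms(3) by (auto simp: lattice_form_def lin)
  also have "\<dots> \<longleftrightarrow> (\<forall>j. Poly_Mapping.lookup m j \<le> Poly_Mapping.lookup p j)"
    by (meson leD leI le_less_trans less_le order_refl)
  also have "\<dots> \<longleftrightarrow> m = p"
  proof
    assume le: "\<forall>j. Poly_Mapping.lookup m j \<le> Poly_Mapping.lookup p j"
    show "m = p"
    proof (rule poly_mapping_eqI, rule ccontr)
      fix j assume "Poly_Mapping.lookup m j \<noteq> Poly_Mapping.lookup p j"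
      then have "(\<Sum>j\<in>UNIV. Poly_Mapping.lookup m j) < (\<Sum>j\<in>UNIV. Poly_Mapping.lookup p j)"
        using le by (intro sum_strict_mono_ex1) (auto intro!: exI[of _ j] le_neq_trans)
      then show False
        using assms(1,2) by (simp add: mdeg_UNIV)
    qed
  qed simp
  finally show ?thesis .
qed

text \<open>For \<open>e = 0\<close> the only lattice point is the origin, at which the sum of the variables vanishes; a unit
  vector with the constant form replaces it.\<close>

lemma dual_points_exist:
  fixes e s :: nat
  defines "q \<equiv> expected_h TYPE('n::finite) s e"
  shows "\<exists>(p :: nat \<Rightarrow> 'n \<Rightarrow> 'k::field_char_0) g. g \<in> forms_family e \<and>
    (\<forall>k<q. mpoly_eval sum_of_vars (p k) \<noteq> 0) \<and>
    (\<forall>i<q. \<forall>k<q. mpoly_eval (g i) (p k) \<noteq> 0 \<longleftrightarrow> i = k)"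
proof (cases "e = 0")
  case True
  have "q \<le> 1"
    by (simp add: q_def expected_h_def True card_exponents)
  then show ?thesis
    using True
    \<comment> \<open>\<open>undefined\<close> serves as an arbitrary variable\<close>
    by (intro exI[of _ "\<lambda>_ j. if j = undefined then 1 else 0"] exI[of _ "\<lambda>_. 1"])
       (auto simp: forms_family_def)
next
  case False
  obtain ms where ms: "set ms = {m :: 'n \<Rightarrow>\<^sub>0 nat. mdeg m = e}" "distinct ms"
    using finite_distinct_list[OF finite_exponents] by blast
  have len: "q \<le> length ms"
    using distinct_card[OF ms(2)] ms(1) by (simp add: q_def expected_h_def)
  have deg: "mdeg (ms ! k) = e" if "k < q" for k
    using nth_mem[of k ms] that len unfolding ms(1) by simp
  define g where "g k = (if k < q then lattice_form e (ms ! k) else 0 :: ('n, 'k) mpoly)" for k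
  define p where "p k = (\<lambda>j. of_nat (Poly_Mapping.lookup (ms ! k) j) :: 'k)" for k
  have "g k \<in> hom_part e" for k
    using lattice_form_hom[of e "ms ! k", where 'k = 'k] deg[of k] by (auto simp: g_def)
  moreover have "mpoly_eval sum_of_vars (p k) \<noteq> 0" if "k < q" for k
    using deg[OF that] False by (simp add: p_def mdeg_UNIV flip: of_nat_sum)
  moreover have "mpoly_eval (g i) (p k) \<noteq> 0 \<longleftrightarrow> i = k" if "i < q" "k < q" for i k
    using lattice_form_eval_nonzero_iff[of "ms ! i" e "ms ! k", where 'k = 'k] that deg False len
      nth_eq_iff_index_eq[OF ms(2)] by (simp add: g_def p_def)
  ultimately show ?thesis
    by (intro exI[of _ p] exI[of _ g]) (simp add: forms_family_def)
qed

text \<open>All points beyond the first \<open>q\<close> are placed at the origin, where the summands of the Gram matrix, being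
  values of forms of degree \<open>d \<ge> 1\<close>, vanish. The duality of points and forms makes the matrix diagonal.\<close>

lemma gram_det_witness:
  assumes d: "d \<ge> 1" and e: "e \<le> d div 2"
  obtains a :: "nat \<times> 'n::finite \<Rightarrow> 'k::field_char_0" and g where
    "a \<in> {1..s} \<times> UNIV \<rightarrow>\<^sub>E UNIV" "g \<in> forms_family e" "gram_det d s e sum_of_vars g a \<noteq> 0"
proof -
  let ?q = "expected_h TYPE('n) s e"
  obtain p :: "nat \<Rightarrow> 'n \<Rightarrow> 'k" and g where g: "g \<in> forms_family e"
    and p: "\<And>k. k < ?q \<Longrightarrow> mpoly_eval sum_of_vars (p k) \<noteq> 0"
    and dual: "\<And>i k. i < ?q \<Longrightarrow> k < ?q \<Longrightarrow> mpoly_eval (g i) (p k) \<noteq> 0 \<longleftrightarrow> i = k"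
    using dual_points_exist[of e s, where 'n = 'n and 'k = 'k] by blast
  define a where "a = restrict (\<lambda>(k, j). if k \<le> ?q then p (k - 1) j else 0) ({1..s} \<times> UNIV)"
  have a: "(\<lambda>x. a (k, x)) = (if k \<le> ?q then p (k - 1) else (\<lambda>_. 0))" if "k \<in> {1..s}" for k
    using that by (auto simp: a_def)
  have q: "?q \<le> s"
    by (simp add: expected_h_def)
  have entry: "(\<Sum>k\<in>{1..s}. mpoly_eval sum_of_vars (\<lambda>x. a (k, x)) ^ (d - 2 * e) *
        (mpoly_eval (g i) (\<lambda>x. a (k, x)) * mpoly_eval (g j) (\<lambda>x. a (k, x)))) =
      (if i = j then mpoly_eval sum_of_vars (p i) ^ (d - 2 * e) * mpoly_eval (g i) (p i) ^ 2 else 0)"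
    if ij: "i < ?q" "j < ?q" for i j
  proof -
    have "(\<Sum>k\<in>{1..s}. mpoly_eval sum_of_vars (\<lambda>x. a (k, x)) ^ (d - 2 * e) *
        (mpoly_eval (g i) (\<lambda>x. a (k, x)) * mpoly_eval (g j) (\<lambda>x. a (k, x)))) =
      (\<Sum>k\<in>{1..s}. if k = Suc i then
        (if i = j then mpoly_eval sum_of_vars (p i) ^ (d - 2 * e) * mpoly_eval (g i) (p i) ^ 2 else 0)
        else 0)"
    proof (rule sum.cong[OF refl])
      fix k assume k: "k \<in> {1..s}"
      show "mpoly_eval sum_of_vars (\<lambda>x. a (k, x)) ^ (d - 2 * e) *
        (mpoly_eval (g i) (\<lambda>x. a (k, x)) * mpoly_eval (g j) (\<lambda>x. a (k, x))) =
        (if k = Suc i then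
        (if i = j then mpoly_eval sum_of_vars (p i) ^ (d - 2 * e) * mpoly_eval (g i) (p i) ^ 2 else 0)
        else 0)"
      proof (cases "k \<le> ?q")
        case True
        then show ?thesis
          unfolding a[OF k] using dual[of i "k - 1"] dual[of j "k - 1"] ij k
          by (auto simp: power2_eq_square simp del: mpoly_eval_lin_form)
      next
        case False
        then have "k \<noteq> Suc i"
          using ij by simp
        have "(\<lambda>x. a (k, x)) = (\<lambda>_. 0)"
          unfolding a[OF k] using False by simp
        moreover have "mpoly_eval (g i) (\<lambda>_. 0) = 0" if "e > 0"
          using mpoly_eval_origin[of "g i" e] g that by (simp add: forms_family_def)
        moreover have "mpoly_eval sum_of_vars (\<lambda>_ :: 'n. 0 :: 'k) ^ (d - 2 * e) = 0" if "e = 0"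
          using d that by simp
        ultimately show ?thesis
          using \<open>k \<noteq> Suc i\<close> by (cases "e = 0") (simp_all del: mpoly_eval_lin_form)
      qed
    qed
    also have "\<dots> = (if i = j then
        mpoly_eval sum_of_vars (p i) ^ (d - 2 * e) * mpoly_eval (g i) (p i) ^ 2 else 0)"
      using ij q by simp
    finally show ?thesis .
  qed
  have "gram_det d s e sum_of_vars g a \<noteq> 0"
    unfolding gram_det_def det_mat_nonzero_iff
  proof (intro allI impI)
    fix c i assume *: "\<forall>i<?q. (\<Sum>j<?q. (\<lambda>(i, j). \<Sum>k\<in>{1..s}.
      mpoly_eval sum_of_vars (\<lambda>x. a (k, x)) ^ (d - 2 * e) *
        (mpoly_eval (g i) (\<lambda>x. a (k, x)) * mpoly_eval (g j) (\<lambda>x. a (k, x)))) (i, j) * c j) = 0"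
      and i: "i < ?q"
    let ?n = "mpoly_eval sum_of_vars (p i) ^ (d - 2 * e) * mpoly_eval (g i) (p i) ^ 2"
    have "0 = (\<Sum>j<?q. (if i = j then ?n else 0) * c j)"
      using *[rule_format, OF i] entry[OF i] by (simp del: mpoly_eval_lin_form)
    also have "\<dots> = (\<Sum>j<?q. if j = i then ?n * c i else 0)"
      by (rule sum.cong) auto
    also have "\<dots> = ?n * c i"
      using i by simp
    finally show "c i = 0"
      using p[OF i] dual[OF i i] by auto
  qed
  moreover have "a \<in> {1..s} \<times> UNIV \<rightarrow>\<^sub>E UNIV"
    by (auto simp: a_def)
  ultimately show ?thesis
    using that g by blast
qed

section \<open>Genericity\<close>

lemma regular_fun_gram_det:
  assumes "\<And>k. k \<in> {1..s} \<Longrightarrow> regular_fun I (\<lambda>c. mpoly_eval (l c) (\<lambda>x. a c (k, x)))"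
    and "\<And>k i. k \<in> {1..s} \<Longrightarrow> regular_fun I (\<lambda>c. mpoly_eval (g i) (\<lambda>x. a c (k, x)))"
  shows "regular_fun I (\<lambda>c. gram_det d s e (l c) g (a c))"
  unfolding gram_det_def
  by (intro regular_fun_det)
     (auto intro!: regular_fun_sum regular_fun_mult regular_fun_power assms)

lemma zariski_open_gram:
  assumes "\<And>k. k \<in> {1..s} \<Longrightarrow> regular_fun I (\<lambda>c. mpoly_eval (l c) (\<lambda>x. a c (k, x)))"
    and "\<And>k i g. k \<in> {1..s} \<Longrightarrow> g \<in> forms_family e \<Longrightarrow>
      regular_fun I (\<lambda>c. mpoly_eval (g i) (\<lambda>x. a c (k, x)))"
  shows "zariski_open I {c \<in> I \<rightarrow>\<^sub>E UNIV. \<exists>g\<in>forms_family e. gram_det d s e (l c) g (a c) \<noteq> 0}"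
proof -
  have "{c \<in> I \<rightarrow>\<^sub>E UNIV. \<exists>g\<in>forms_family e. gram_det d s e (l c) g (a c) \<noteq> 0} =
      {c \<in> I \<rightarrow>\<^sub>E UNIV. \<exists>f\<in>(\<lambda>g c. gram_det d s e (l c) g (a c)) ` forms_family e. f c \<noteq> 0}"
    by auto
  moreover have "zariski_open I \<dots>"
    by (rule zariski_open_regular_funs) (use assms in \<open>auto intro!: regular_fun_gram_det\<close>)
  ultimately show ?thesis by simp
qed

text \<open>The configurations of points for which the \<open>h\<close>-vector is as large as possible up to the middle degree
  and the sum of the variables is a strong Lefschetz element.\<close>

definition good_points :: "nat \<Rightarrow> nat \<Rightarrow> (nat \<times> 'n::finite \<Rightarrow> 'k::field_char_0) set" where
  "good_points d s = {a \<in> {1..s} \<times> UNIV \<rightarrow>\<^sub>E UNIV. \<forall>e\<le>d div 2.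
     \<exists>g\<in>forms_family e. gram_det d s e sum_of_vars g a \<noteq> 0}"

text \<open>Each degree contributes one nonempty open condition; irreducibility makes finitely many of them
  compatible, so no single configuration has to serve all degrees at once.\<close>

lemma good_points_generic:
  fixes d s :: nat
  assumes "d \<ge> 1"
  shows "zariski_open ({1..s} \<times> UNIV) (good_points d s :: (nat \<times> 'n::finite \<Rightarrow> 'k::field_char_0) set)"
    and "(good_points d s :: (nat \<times> 'n::finite \<Rightarrow> 'k::field_char_0) set) \<noteq> {}"
proof -
  let ?I = "{1..s} \<times> (UNIV :: 'n set)"
  define V where "V e = {a \<in> ?I \<rightarrow>\<^sub>E (UNIV :: 'k set).
    \<exists>g\<in>forms_family e. gram_det d s e sum_of_vars g a \<noteq> 0}" for e
  have reg: "regular_fun ?I (\<lambda>a :: nat \<times> 'n \<Rightarrow> 'k. mpoly_eval p (\<lambda>x. a (k, x)))" if "k \<in> {1..s}" for p k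
    using that by (intro regular_fun_mpoly_eval regular_fun_var) auto
  have V: "zariski_open ?I (V e) \<and> V e \<noteq> {}" if e: "e \<in> {..d div 2}" for e
  proof
    show "zariski_open ?I (V e)"
      unfolding V_def by (intro zariski_open_gram reg)
    have "e \<le> d div 2"
      using e by simp
    then obtain a :: "nat \<times> 'n \<Rightarrow> 'k" and g where "a \<in> ?I \<rightarrow>\<^sub>E UNIV" "g \<in> forms_family e"
      "gram_det d s e sum_of_vars g a \<noteq> 0"
      by (rule gram_det_witness[OF assms])
    then have "a \<in> V e"
      unfolding V_def by blast
    then show "V e \<noteq> {}"
      by blast
  qed
  have "good_points d s = (?I \<rightarrow>\<^sub>E UNIV) \<inter> (\<Inter>e\<in>{..d div 2}. V e)"
    by (auto simp: good_points_def V_def)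
  with zariski_open_INT[of "{..d div 2}" ?I V] V
  show "zariski_open ?I (good_points d s :: (nat \<times> 'n \<Rightarrow> 'k) set)"
    "(good_points d s :: (nat \<times> 'n \<Rightarrow> 'k) set) \<noteq> {}"
    by auto
qed

section \<open>Generic linear forms\<close>

lemma hom_part_one_lin_form:
  assumes "p \<in> hom_part 1"
  obtains u where "p = lin_form (u :: 'n::finite \<Rightarrow> 'k::semiring_1)"
proof -
  have deg_one: "\<exists>j. m = Poly_Mapping.single j 1" if m: "mdeg m = 1" for m :: "'n \<Rightarrow>\<^sub>0 nat"
  proof -
    have "m \<noteq> 0"
      using m by auto
    then obtain j where j: "Poly_Mapping.lookup m j \<noteq> 0"
      by (metis poly_mapping_eqI lookup_zero)
    have "mdeg (m - Poly_Mapping.single j 1) = 0"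
      using m mdeg_add[of "m - Poly_Mapping.single j 1" "Poly_Mapping.single j 1"]
      unfolding exponent_split[OF j] by simp
    then have "m - Poly_Mapping.single j 1 = 0"
      by (auto simp: mdeg_UNIV intro!: poly_mapping_eqI)
    then show ?thesis
      using exponent_split[OF j] by (metis add_0)
  qed
  define u where "u j = Poly_Mapping.lookup p (Poly_Mapping.single j 1)" for j
  have "p = lin_form u"
  proof (rule poly_mapping_eqI)
    fix m
    have lookup: "Poly_Mapping.lookup (lin_form u) m =
        (\<Sum>j\<in>UNIV. if Poly_Mapping.single j 1 = m then u j else 0)"
      by (simp add: lin_form_def lookup_sum lookup_single when_def)
    show "Poly_Mapping.lookup p m = Poly_Mapping.lookup (lin_form u) m"
    proof (cases "mdeg m = 1")
      case True
      then obtain i where i: "m = Poly_Mapping.single i 1"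
        using deg_one by blast
      have "Poly_Mapping.single j 1 = m \<longleftrightarrow> j = i" for j
        unfolding i by (metis lookup_single_eq lookup_single_not_eq zero_neq_one)
      then show ?thesis
        unfolding lookup by (simp add: i u_def)
    next
      case False
      then have "Poly_Mapping.single j 1 \<noteq> m" for j
        by auto
      then show ?thesis
        unfolding lookup using False assms by (auto simp: hom_part_iff)
    qed
  qed
  then show ?thesis by (rule that)
qed

text \<open>Coordinates on the degree one part: the variables span it, and a basis extracted from their span is
  again represented by linear forms.\<close>

lemma (in macaulay_dual) linear_forms_basis:
  obtains u :: "nat \<Rightarrow> 'n \<Rightarrow> 'k" and h where
    "is_basis F (map (\<lambda>i. cls F (lin_form (u i))) [0..<h]) (graded_part F 1)"
proof -
  obtain xs :: "'n list" where xs: "distinct xs" "set xs = UNIV"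
    using finite_distinct_list[OF finite_class.finite_UNIV] by blast
  let ?X = "\<lambda>j. Poly_Mapping.single (Poly_Mapping.single j 1) 1 :: ('n, 'k) mpoly"
  let ?Us = "map (\<lambda>j. cls F (?X j)) xs"
  have Us: "set ?Us \<subseteq> carrier (alg F)"
    by (auto simp: carrier_alg)
  have lin: "lin_form c = (\<Sum>j\<in>set xs. mconst (c j) * ?X j)" for c
    by (simp add: lin_form_def xs(2) mconst_def mult_single)
  have comb: "alg.combine (map (\<lambda>j. cls F (mconst (c j))) xs) ?Us = cls F (lin_form c)" for c
    unfolding combine_cls lin sum_list_distinct_conv_sum_set[OF xs(1)] ..
  have "alg.Span (scalars F) ?Us = graded_part F 1"
  proof
    show "alg.Span (scalars F) ?Us \<subseteq> graded_part F 1"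
    proof
      fix x assume "x \<in> alg.Span (scalars F) ?Us"
      then obtain Ks where Ks: "length Ks = length ?Us" "set Ks \<subseteq> scalars F" "x = alg.combine Ks ?Us"
        unfolding alg.Span_eq_combine_set_length_version[OF subfield_scalars Us] by blast
      obtain c where "Ks = map (\<lambda>t. cls F (mconst (c t))) xs"
        by (rule scalar_list_as_function[OF xs(1), of Ks]) (use Ks in auto)
      then have "x = cls F (lin_form c)"
        unfolding Ks(3) comb[symmetric] by (rule arg_cong)
      then show "x \<in> graded_part F 1"
        unfolding graded_part_def using hom_part_lin_form by blast
    qed
    show "graded_part F 1 \<subseteq> alg.Span (scalars F) ?Us"
    proof
      fix x assume "x \<in> graded_part F 1"
      then obtain c where "x = cls F (lin_form c)"
        unfolding graded_part_def using hom_part_one_lin_form by (metis imageE)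
      moreover have "set (map (\<lambda>j. cls F (mconst (c j))) xs) \<subseteq> scalars F"
        by (auto simp: scalars_def)
      ultimately show "x \<in> alg.Span (scalars F) ?Us"
        unfolding alg.Span_eq_combine_set[OF subfield_scalars Us] comb[symmetric] by blast
    qed
  qed
  then obtain Vs where Vs: "set Vs \<subseteq> carrier (alg F)" "alg.independent (scalars F) Vs"
    "alg.Span (scalars F) Vs = graded_part F 1"
    using alg.filter_base[OF subfield_scalars Us] by metis
  have "\<exists>c. Vs ! i = cls F (lin_form c)" if "i < length Vs" for i
  proof -
    have "Vs ! i \<in> graded_part F 1"
      using alg.Span_base_incl[OF subfield_scalars Vs(1)] Vs(3) nth_mem[OF that] by blast
    then show ?thesis
      unfolding graded_part_def using hom_part_one_lin_form by (metis imageE)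
  qed
  then obtain u where "\<And>i. i < length Vs \<Longrightarrow> Vs ! i = cls F (lin_form (u i))"
    by metis
  then have "Vs = map (\<lambda>i. cls F (lin_form (u i))) [0..<length Vs]"
    by (intro nth_equalityI) auto
  then have "is_basis F (map (\<lambda>i. cls F (lin_form (u i))) [0..<length Vs]) (graded_part F 1)"
    using Vs(2,3) by (simp add: is_basis_def)
  then show ?thesis by (rule that)
qed

lemma (in macaulay_dual) ann_power_diff: "p - q \<in> ann F \<Longrightarrow> p ^ k - q ^ k \<in> ann F"
  unfolding power_diff_sumr2 by (rule ann_mult_right)

text \<open>The Gram determinants are regular functions of the coordinates of the linear form. They depend only on
  its class, so the coordinates \<open>c0\<close> of \<open>l\<close> itself witness that the conditions are satisfiable, and every
  linear form satisfying them yields the same Jordan type.\<close>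

lemma (in power_sum_lefschetz) generic_jordan_type:
  "has_generic_linear_jordan_type F
     (\<Sum>i\<le>d div 2. replicate_mset (nat (h_diff F i)) (d + 1 - 2 * i))"
proof -
  obtain u :: "nat \<Rightarrow> 'n \<Rightarrow> 'k" and h where
    basis: "is_basis F (map (\<lambda>i. cls F (lin_form (u i))) [0..<h]) (graded_part F 1)"
    by (rule linear_forms_basis)
  let ?Us = "map (\<lambda>i. cls F (lin_form (u i))) [0..<h]"
  define form where "form c = (\<Sum>i<h. mconst (c i) * lin_form (u i))" for c
  have form_hom: "form c \<in> hom_part 1" for c
    unfolding form_def by (intro hom_part_sum hom_part_scale hom_part_lin_form)
  have lincomb: "lincomb F c ?Us = cls F (form c)" for c
    by (simp add: lincomb_cls form_def)
  have Us: "set ?Us \<subseteq> carrier (alg F)"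
    by (auto simp: carrier_alg)
  define V where "V e = {c \<in> {..<h} \<rightarrow>\<^sub>E UNIV.
    \<exists>g\<in>forms_family e. gram_det d s e (form c) g a \<noteq> 0}" for e
  obtain c0 where c0: "c0 \<in> {..<h} \<rightarrow>\<^sub>E UNIV" "l - form c0 \<in> ann F"
  proof -
    have "cls F l \<in> alg.Span (scalars F) ?Us"
      using basis l by (simp add: is_basis_def graded_part_def)
    then obtain Ks where Ks: "length Ks = length ?Us" "set Ks \<subseteq> scalars F" "cls F l = alg.combine Ks ?Us"
      unfolding alg.Span_eq_combine_set_length_version[OF subfield_scalars Us] by blast
    obtain c where c: "Ks = map (\<lambda>i. cls F (mconst (c i))) [0..<h]"
      by (rule scalar_list_as_function[of "[0..<h]" Ks]) (use Ks in auto)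
    have "cls F l = cls F (form (restrict c {..<h}))"
      unfolding Ks(3) c combine_cls
      by (simp add: interv_sum_list_conv_sum_set_nat atLeast0LessThan form_def)
    then show ?thesis
      using that[of "restrict c {..<h}"] by (auto simp: cls_eq_iff)
  qed
  have V: "zariski_open {..<h} (V e) \<and> V e \<noteq> {}" if e: "e \<in> {..d div 2}" for e
  proof
    show "zariski_open {..<h} (V e)"
      unfolding V_def form_def
      by (intro zariski_open_gram)
         (auto intro!: regular_fun_sum regular_fun_mult regular_fun_const regular_fun_var)
    have "e \<le> d div 2"
      using e by simp
    from gram[OF this] obtain g where g: "g \<in> forms_family e" "gram_det d s e l g a \<noteq> 0"
      by blast
    have "dual_functional d s a (l ^ (d - 2 * e) * p) = dual_functional d s a (form c0 ^ (d - 2 * e) * p)" for p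
      using psi_congruent[OF ann_power_diff[OF c0(2)], of p] by (simp add: mult.commute)
    then have "gram_det d s e (form c0) g a = gram_det d s e l g a"
      using e by (simp add: gram_det_dual_functional[OF l g(1)] gram_det_dual_functional[OF form_hom g(1)])
    then have "c0 \<in> V e"
      unfolding V_def using c0(1) g by (intro CollectI conjI bexI[of _ g]) simp_all
    then show "V e \<noteq> {}"
      by blast
  qed
  define W where "W = ({..<h} \<rightarrow>\<^sub>E UNIV) \<inter> (\<Inter>e\<in>{..d div 2}. V e)"
  have W: "zariski_open {..<h} W" "W \<noteq> {}"
    using zariski_open_INT[of "{..d div 2}" "{..<h}" V] V unfolding W_def by auto
  have "has_jordan_type F (cls F (form c))
      (\<Sum>i\<le>d div 2. replicate_mset (nat (h_diff F i)) (d + 1 - 2 * i))" if "c \<in> W" for c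
  proof -
    interpret c: power_sum_lefschetz d s a "form c"
      by unfold_locales (use that s form_hom in \<open>auto simp: W_def V_def\<close>)
    show ?thesis
      by (rule c.jordan_type_h_diff(1))
  qed
  then show ?thesis
    unfolding has_generic_linear_jordan_type_def dense_open_linear_forms_def
    using basis W zariski_dense_open[OF W] lincomb
    by (intro exI[of _ "(\<lambda>c. lincomb F c ?Us) ` W"] conjI exI[of _ ?Us] exI[of _ W]) auto
qed

lemma binomial_mono_upper: "n \<le> m \<Longrightarrow> n choose k \<le> m choose k"
proof (rule lift_Suc_mono_le[of "\<lambda>n. n choose k"])
  show "i choose k \<le> Suc i choose k" for i
    by (cases k) simp_all
qed

theorem theorem5p1:
  fixes d s r m :: nat
  assumes "d \<ge> 1"
    and "CARD('n) \<ge> 2"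
    and "1 \<le> s"
    and "s \<le> (CARD('n) + d - 1) choose d"
    and "(CARD('n) - 2 + r) choose (CARD('n) - 1) < s"
    and "s \<le> (CARD('n) - 1 + r) choose (CARD('n) - 1)"
    and "m = min r (d div 2)"
  shows "\<exists>U :: (nat \<times> 'n::finite \<Rightarrow> 'k::{alg_closed_field, field_char_0}) set.
    zariski_open ({1..s} \<times> UNIV) U \<and> zariski_dense ({1..s} \<times> UNIV) U \<and>
    (\<forall>a\<in>U.
      let F = power_sum d s a;
          P = add_mset (d + 1) (\<Sum>i=1..m. replicate_mset (nat (h_diff F i)) (d + 1 - 2 * i))
      in has_generic_linear_jordan_type F P \<and>
         (\<forall>i\<le>m. int (count P (d + 1 - 2 * i)) = h_diff F i))"
proof (intro exI[of _ "good_points d s"] conjI ballI)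
  show "zariski_open ({1..s} \<times> UNIV) (good_points d s :: (nat \<times> 'n \<Rightarrow> 'k) set)"
    by (rule good_points_generic(1)[OF assms(1)])
  then show "zariski_dense ({1..s} \<times> UNIV) (good_points d s :: (nat \<times> 'n \<Rightarrow> 'k) set)"
    using good_points_generic(2)[OF assms(1)] by (rule zariski_dense_open)
  fix a :: "nat \<times> 'n \<Rightarrow> 'k" assume a: "a \<in> good_points d s"
  interpret power_sum_lefschetz d s a sum_of_vars
    by unfold_locales (use a assms(3) hom_part_lin_form in \<open>auto simp: good_points_def\<close>)
  define P where "P = add_mset (d + 1) (\<Sum>i=1..m. replicate_mset (nat (h_diff F i)) (d + 1 - 2 * i))"
  have m: "m \<le> d div 2" "2 * m \<le> d"
    using assms(7) by auto
  have h0: "h_diff F 0 = 1"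
    using assms(3) by (simp add: h_diff_def h_vec_power_sum expected_h_def card_exponents)
  \<comment> \<open>from degree \<open>r\<close> on the \<open>s\<close> points impose independent conditions, so the \<open>h\<close>-vector is constant\<close>
  have h_stable: "h_diff F i = 0" if i: "i \<in> {m<..d div 2}" for i
  proof -
    have "expected_h TYPE('n) s j = s" if "r \<le> j" for j
    proof -
      have "s \<le> (CARD('n) - 1 + j) choose (CARD('n) - 1)"
        using assms(6) binomial_mono_upper[OF add_left_mono[OF that]] by (rule order_trans)
      then show ?thesis
        by (simp only: expected_h_def card_exponents min_absorb1)
    qed
    moreover have "r \<le> i" "r \<le> i - 1" "i \<noteq> 0" "i \<le> d div 2" "i - 1 \<le> d div 2"
      using i assms(7) by auto
    ultimately show ?thesis
      by (simp add: h_diff_def h_vec_power_sum)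
  qed
  have P_eq: "P = (\<Sum>i\<le>m. replicate_mset (nat (h_diff F i)) (d + 1 - 2 * i))"
    unfolding P_def atMost_atLeast0
    by (subst sum.atLeast_Suc_atMost) (simp_all add: h0)
  also have "\<dots> = (\<Sum>i\<le>d div 2. replicate_mset (nat (h_diff F i)) (d + 1 - 2 * i))"
    by (rule sum.mono_neutral_left) (use m h_stable in auto)
  finally have "has_generic_linear_jordan_type F P"
    using generic_jordan_type by simp
  moreover have "int (count P (d + 1 - 2 * i)) = h_diff F i" if i: "i \<le> m" for i
  proof -
    have "count P (d + 1 - 2 * i) = (\<Sum>j\<le>m. count (replicate_mset (nat (h_diff F j)) (d + 1 - 2 * j)) (d + 1 - 2 * i))"
      unfolding P_eq by (rule count_sum)
    also have "\<dots> = (\<Sum>j\<le>m. if j = i then nat (h_diff F i) else 0)"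
      by (rule sum.cong) (use m i in auto)
    also have "\<dots> = nat (h_diff F i)"
      using i by simp
    finally show ?thesis
      using jordan_type_h_diff(2)[of i] i m by simp
  qed
  ultimately show "let F = power_sum d s a;
          P = add_mset (d + 1) (\<Sum>i=1..m. replicate_mset (nat (h_diff F i)) (d + 1 - 2 * i))
      in has_generic_linear_jordan_type F P \<and>
         (\<forall>i\<le>m. int (count P (d + 1 - 2 * i)) = h_diff F i)"
    unfolding Let_def P_def by blast
qed

end
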